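(* Let $G$ be a bridgeless cubic graph (multiple edges allowed, no loops) with a $2$-factor consisting of two circuits. Then $G$ has a perfect matching cover of order $5$, i.e. there are five perfect matchings of $G$ (not necessarily distinct) such that every edge of $G$ lies in at least one of them.
   Context: A $2$-factor is a spanning 2-regular subgraph; a circuit is a cycle. A perfect matching is the edge set of a spanning 1-regular subgraph. A perfect matching cover is a collection of perfect matchings such that each edge is contained in at least one of them; its order is the number of perfect matchings in it. *)

theory Defs
  imports "HOL-Library.Multiset"
begin

text \<open>
  Undirected multigraphs: edges are abstract objects, so distinct edges may have the same ends.
  The value of \<open>ends\<close> outside the edge set is irrelevant.
\<close>
record ('v, 'e) multigraph =
  verts :: "'v set"
  edges :: "'e set"
  ends  :: "'e \<Rightarrow> 'v set"

text \<open>Finite loopless graphs: every edge has exactly two (different) ends.\<close>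
definition loopless_graph :: "('v, 'e) multigraph \<Rightarrow> bool" where
  "loopless_graph G \<longleftrightarrow> finite (verts G) \<and> finite (edges G) \<and>
     (\<forall>e\<in>edges G. ends G e \<subseteq> verts G \<and> card (ends G e) = 2)"

text \<open>Only meaningful for loopless graphs, as a loop would have to be counted twice.\<close>
definition degree :: "('v, 'e) multigraph \<Rightarrow> 'v \<Rightarrow> nat" where
  "degree G v = card {e \<in> edges G. v \<in> ends G e}"

definition regular :: "nat \<Rightarrow> ('v, 'e) multigraph \<Rightarrow> bool" where
  "regular k G \<longleftrightarrow> (\<forall>v\<in>verts G. degree G v = k)"

abbreviation cubic :: "('v, 'e) multigraph \<Rightarrow> bool" where
  "cubic G \<equiv> regular 3 G"

definition subgraph :: "('v, 'e) multigraph \<Rightarrow> ('v, 'e) multigraph \<Rightarrow> bool" where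
  "subgraph H G \<longleftrightarrow> loopless_graph H \<and> verts H \<subseteq> verts G \<and> edges H \<subseteq> edges G \<and>
     (\<forall>e\<in>edges H. ends H e = ends G e)"

definition spanning_subgraph :: "('v, 'e) multigraph \<Rightarrow> ('v, 'e) multigraph \<Rightarrow> bool" where
  "spanning_subgraph H G \<longleftrightarrow> subgraph H G \<and> verts H = verts G"

definition factor :: "nat \<Rightarrow> ('v, 'e) multigraph \<Rightarrow> ('v, 'e) multigraph \<Rightarrow> bool" where
  "factor k F G \<longleftrightarrow> spanning_subgraph F G \<and> regular k F"

definition reachable :: "('v, 'e) multigraph \<Rightarrow> 'v \<Rightarrow> 'v \<Rightarrow> bool" where
  "reachable G u v \<longleftrightarrow> (u, v) \<in> {(x, y). \<exists>e\<in>edges G. ends G e = {x, y}}\<^sup>*"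

definition delete_edge :: "'e \<Rightarrow> ('v, 'e) multigraph \<Rightarrow> ('v, 'e) multigraph" where
  "delete_edge e G = G\<lparr>edges := edges G - {e}\<rparr>"

text \<open>A bridge is an edge whose deletion separates its two ends.\<close>
definition bridge :: "('v, 'e) multigraph \<Rightarrow> 'e \<Rightarrow> bool" where
  "bridge G e \<longleftrightarrow> e \<in> edges G \<and>
     (\<exists>u v. ends G e = {u, v} \<and> \<not> reachable (delete_edge e G) u v)"

definition bridgeless :: "('v, 'e) multigraph \<Rightarrow> bool" where
  "bridgeless G \<longleftrightarrow> (\<forall>e\<in>edges G. \<not> bridge G e)"

text \<open>
  \<open>C\<close> is a circuit (cycle) if its vertices and edges can be listed without repetition in cyclic
  order, each edge joining two consecutive vertices.  Length \<open>2\<close> is a pair of parallel edges.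
\<close>
definition circuit :: "('v, 'e) multigraph \<Rightarrow> bool" where
  "circuit C \<longleftrightarrow> (\<exists>vs es. length vs \<ge> 2 \<and> length es = length vs \<and> distinct vs \<and> distinct es \<and>
     verts C = set vs \<and> edges C = set es \<and>
     (\<forall>i<length vs. ends C (es ! i) = {vs ! i, vs ! (Suc i mod length vs)}))"

definition consists_of_two_circuits :: "('v, 'e) multigraph \<Rightarrow> bool" where
  "consists_of_two_circuits F \<longleftrightarrow> (\<exists>C D. subgraph C F \<and> subgraph D F \<and> circuit C \<and> circuit D \<and>
     verts C \<inter> verts D = {} \<and> verts F = verts C \<union> verts D \<and> edges F = edges C \<union> edges D)"

definition perfect_matching :: "('v, 'e) multigraph \<Rightarrow> 'e set \<Rightarrow> bool" where
  "perfect_matching G M \<longleftrightarrow> (\<exists>F. factor 1 F G \<and> edges F = M)"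

text \<open>
  A cover is a multiset of perfect matchings, so that repetitions are allowed and its order is
  its \<open>size\<close>.
\<close>
definition perfect_matching_cover :: "('v, 'e) multigraph \<Rightarrow> 'e set multiset \<Rightarrow> bool" where
  "perfect_matching_cover G \<M> \<longleftrightarrow> (\<forall>M\<in>#\<M>. perfect_matching G M) \<and>
     (\<forall>e\<in>edges G. \<exists>M\<in>#\<M>. e \<in> M)"

end

theory Submission
  imports Defs
begin

text \<open>
  Let \<open>M\<close> be the complement of the 2-factor. If both circuits are even, then \<open>M\<close> and the two alternating
  matchings of the 2-factor suffice. Otherwise both circuits are odd, and an odd number of edges of \<open>M\<close> cross
  between them; a single crossing would be a bridge, so there are at least three. Fix two crossing
  edges with ends \<open>a, b\<close> on one circuit. There is a third crossing vertex \<open>c\<close> such that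
  the circuit edges are covered by three matchings which use circuit edges and chords and miss exactly
  \<open>a\<close>, \<open>b\<close>, \<open>c\<close>, respectively; likewise on the other circuit, with
  the mates of \<open>a, b\<close> and some \<open>d\<close>. Gluing these along the crossing edges at \<open>a\<close>, \<open>b\<close>, \<open>c\<close>, \<open>d\<close> gives
  four perfect matchings which together with \<open>M\<close> form the cover.

  To find \<open>c\<close>, delete pairs of consecutive vertices from the circuit, closing it up, as long as
  \<open>a, b\<close> and chords stay intact. In a shortest such circuit exactly three crossing vertices are left, and
  the chords form the only perfect matching on the remaining vertices. By Kotzig's theorem the matching
  then contains a bridge (unless no chord is left), so one of the three arcs between the crossing vertices is left by exactly
  one chord. In this situation the three matchings can be written down, and they lift back to the
  original circuit.
\<close>

section \<open>Involutions\<close>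

text \<open>
  Matchings are encoded by involutions; a fixed point is an unmatched vertex.
\<close>

definition invol_on :: "'v set \<Rightarrow> ('v \<Rightarrow> 'v) \<Rightarrow> bool" where
  "invol_on S f \<longleftrightarrow> (\<forall>v\<in>S. f v \<in> S \<and> f (f v) = v)"

lemma invol_onD:
  assumes "invol_on S f" "v \<in> S"
  shows "f v \<in> S" "f (f v) = v"
  using assms by (auto simp: invol_on_def)

lemma invol_on_Diff: "invol_on S f \<Longrightarrow> invol_on T f \<Longrightarrow> invol_on (S - T) f"
  by (auto simp: invol_on_def)

lemma invol_on_Un: "invol_on S f \<Longrightarrow> invol_on T f \<Longrightarrow> invol_on (S \<union> T) f"
  by (auto simp: invol_on_def)

lemma invol_on_even_card:
  assumes "finite S" "invol_on S f" "\<And>v. v \<in> S \<Longrightarrow> f v \<noteq> v"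
  shows "even (card S)"
  using assms
proof (induction "card S" arbitrary: S rule: less_induct)
  case less
  show ?case
  proof (cases "S = {}")
    case False
    then obtain v where v: "v \<in> S" by blast
    let ?P = "{v, f v}"
    have P: "invol_on ?P f" "?P \<subseteq> S"
      using less.prems(2) v by (auto simp: invol_on_def)
    have c2: "card ?P = 2" using less.prems(3)[OF v] by (metis card_2_iff)
    have "card (S - ?P) = card S - 2"
      using P(2) c2 by (simp add: card_Diff_subset)
    moreover have "card S \<ge> 2" using c2 P(2) less.prems(1) card_mono by metis
    moreover have "even (card (S - ?P))"
      using less.hyps[of "S - ?P"] calculation less.prems invol_on_Diff[OF less.prems(2) P(1)] by auto
    ultimately show ?thesis by simp
  qed simp
qed

text \<open>
  \<open>Y\<close> is a path from \<open>y\<close> along which \<open>\<alpha>\<close> and \<open>\<beta>\<close> alternate; \<open>v\<close> is its last vertex, to be continued by \<open>\<beta>\<close>.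
\<close>
lemma alternating_component_step:
  assumes "finite W" "invol_on W \<alpha>" "invol_on W \<beta>"
    and "Y \<subseteq> W" "y \<in> Y" "v \<in> Y"
    and "\<And>w. w \<in> Y - {v} \<Longrightarrow> \<alpha> w \<in> Y \<and> \<beta> w \<in> Y" "\<alpha> v \<in> Y"
    and "\<And>w. w \<in> Y - {v} \<Longrightarrow> \<alpha> w = w \<or> \<beta> w = w \<Longrightarrow> w = y" "\<alpha> v = v \<Longrightarrow> v = y"
  shows "\<exists>Y' t. Y' \<subseteq> W \<and> y \<in> Y' \<and> invol_on Y' \<alpha> \<and> invol_on Y' \<beta> \<and>
           {w \<in> Y'. \<alpha> w = w \<or> \<beta> w = w} \<subseteq> {y, t}"
  using assms
proof (induction "card (W - Y)" arbitrary: Y v \<alpha> \<beta> rule: less_induct)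
  case less
  show ?case
  proof (cases "\<beta> v \<in> Y")
    case True
    have "\<alpha> w \<in> Y \<and> \<beta> w \<in> Y" if "w \<in> Y" for w
      using that True less.prems(7)[of w] less.prems(8) by (cases "w = v") auto
    then have "invol_on Y \<alpha>" "invol_on Y \<beta>"
      using less.prems(2-4) by (auto simp: invol_on_def)
    moreover have "{w \<in> Y. \<alpha> w = w \<or> \<beta> w = w} \<subseteq> {y, v}"
      using less.prems(9) by blast
    ultimately show ?thesis using less.prems(4,5) by blast
  next
    case False
    \<comment> \<open>The path grows by one vertex, and its next edge belongs to
      \<open>\<alpha>\<close>; hence the induction hypothesis is used with the two involutions
      exchanged.\<close>
    let ?v = "\<beta> v" and ?Y = "insert (\<beta> v) Y"
    have vW: "?v \<in> W" "\<beta> ?v = v" "?v \<noteq> v"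
      using less.prems(3,4,6) False by (auto simp: invol_on_def)
    have "card (W - ?Y) < card (W - Y)"
      using False vW(1) less.prems(1) by (intro psubset_card_mono) auto
    moreover have "w = y" if "w \<in> ?Y - {?v}" "\<beta> w = w \<or> \<alpha> w = w" for w
      using that less.prems(9)[of w] less.prems(10) vW(3) by blast
    moreover have "\<beta> w \<in> ?Y \<and> \<alpha> w \<in> ?Y" if "w \<in> ?Y - {?v}" for w
      using that less.prems(7)[of w] less.prems(8) by blast
    ultimately obtain Y' t where "Y' \<subseteq> W" "y \<in> Y'" "invol_on Y' \<beta>" "invol_on Y' \<alpha>"
      "{w \<in> Y'. \<beta> w = w \<or> \<alpha> w = w} \<subseteq> {y, t}"
      using less.hyps[of ?Y \<beta> \<alpha> ?v] less.prems(1-6) vW by auto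
    then show ?thesis by blast
  qed
qed

text \<open>The one-vertex path at \<open>y\<close> satisfies the invariant because
  \<open>\<alpha>\<close> fixes \<open>y\<close>. The result is closed under both involutions and
  has at most two unmatched vertices, which is what the later parity arguments use.\<close>

lemma alternating_component:
  assumes "finite W" "invol_on W \<alpha>" "invol_on W \<beta>" "y \<in> W" "\<alpha> y = y"
  obtains Y t where "Y \<subseteq> W" "y \<in> Y" "invol_on Y \<alpha>" "invol_on Y \<beta>"
    "{w \<in> Y. \<alpha> w = w \<or> \<beta> w = w} \<subseteq> {y, t}"
proof -
  have "\<exists>Y' t. Y' \<subseteq> W \<and> y \<in> Y' \<and> invol_on Y' \<alpha> \<and> invol_on Y' \<beta> \<and>
      {w \<in> Y'. \<alpha> w = w \<or> \<beta> w = w} \<subseteq> {y, t}"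
    using assms by (intro alternating_component_step[where Y = "{y}" and v = y]) simp_all
  then show thesis using that by blast
qed

section \<open>Kotzig's theorem on unique perfect matchings\<close>

text \<open>\<open>\<mu>\<close> is a perfect matching on \<open>V\<close> and \<open>A\<close> the
  adjacency by the remaining edges; \<open>A v (\<mu> v)\<close> stands for an edge parallel to a
  matching edge.\<close>

locale matched_graph =
  fixes V :: "'v set" and \<mu> :: "'v \<Rightarrow> 'v" and A :: "'v \<Rightarrow> 'v \<Rightarrow> bool"
  assumes finite_V: "finite V"
    and invol: "invol_on V \<mu>"
    and no_fixed: "v \<in> V \<Longrightarrow> \<mu> v \<noteq> v"
    and A_sym: "A v w \<Longrightarrow> A w v"
    and A_irrefl: "\<not> A v v"
begin

text \<open>\<open>X\<close> has a perfect matching in the union of \<open>A\<close> and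
  \<open>\<mu>\<close>. For \<open>X\<close> inside \<open>V\<close> fixed points are impossible,
  since neither \<open>A\<close> nor \<open>\<mu>\<close> admits them.\<close>

definition pm :: "'v set \<Rightarrow> bool" where
  "pm X \<longleftrightarrow> (\<exists>\<nu>. invol_on X \<nu> \<and> (\<forall>v\<in>X. A v (\<nu> v) \<or> \<nu> v = \<mu> v))"

lemma pm_Un:
  assumes "pm X" "pm Y" "X \<inter> Y = {}"
  shows "pm (X \<union> Y)"
proof -
  from assms obtain f g where f: "invol_on X f" "\<forall>v\<in>X. A v (f v) \<or> f v = \<mu> v"
    and g: "invol_on Y g" "\<forall>v\<in>Y. A v (g v) \<or> g v = \<mu> v"
    unfolding pm_def by auto
  let ?h = "\<lambda>v. if v \<in> X then f v else g v"
  have "invol_on (X \<union> Y) ?h"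
    using f(1) g(1) assms(3) unfolding invol_on_def by auto
  then show ?thesis unfolding pm_def using f(2) g(2) by (intro exI[of _ ?h]) auto
qed

lemma pm_\<mu>: "invol_on X \<mu> \<Longrightarrow> pm X"
  unfolding pm_def by blast

lemma pm_pair: "A u w \<Longrightarrow> pm {u, w}"
  unfolding pm_def
  by (rule exI[of _ "\<lambda>v. if v = u then w else u"]) (auto simp: invol_on_def A_sym)

definition covered :: "('v \<times> 'v set) list \<Rightarrow> 'v set" where
  "covered xs = (\<Union>(z, B)\<in>set xs. insert z B)"

text \<open>The blossoms without their bases: these are the vertices that \<open>chain_shift\<close>
  can remove together with the last base.\<close>

definition outer :: "('v \<times> 'v set) list \<Rightarrow> 'v set" where
  "outer xs = (\<Union>(z, B)\<in>set xs. B)"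

lemma covered_simps [simp]:
  "covered [] = {}" "covered ((z, B) # xs) = insert z B \<union> covered xs"
  "covered (xs @ ys) = covered xs \<union> covered ys"
  by (auto simp: covered_def)

lemma outer_simps [simp]:
  "outer [] = {}" "outer ((z, B) # xs) = B \<union> outer xs" "outer (xs @ ys) = outer xs \<union> outer ys"
  by (auto simp: outer_def)

lemma outer_subset: "outer xs \<subseteq> covered xs"
  by (auto simp: covered_def outer_def)

text \<open>
  A pair \<open>(z, B)\<close> is a matching edge from \<open>z\<close> to a factor-critical set \<open>B\<close> (a blossom). In a chain each base
  \<open>z\<close> is adjacent to the next blossom. A chain of maximal total size and, among these, minimal length
  can neither be extended nor merged, so its first blossom is closed under adjacency.
\<close>
definition link :: "'v \<Rightarrow> 'v set \<Rightarrow> bool" where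
  "link z B \<longleftrightarrow> z \<in> V \<and> B \<subseteq> V \<and> z \<notin> B \<and> \<mu> z \<in> B \<and> invol_on (B - {\<mu> z}) \<mu> \<and> (\<forall>v\<in>B. pm (B - {v}))"

fun chain :: "('v \<times> 'v set) list \<Rightarrow> bool" where
  "chain [] \<longleftrightarrow> True"
| "chain ((z, B) # xs) \<longleftrightarrow> link z B \<and> insert z B \<inter> covered xs = {} \<and> chain xs \<and>
     (xs \<noteq> [] \<longrightarrow> (\<exists>u\<in>snd (hd xs). A u z))"

lemma link_invol:
  assumes "link z B"
  shows "invol_on (insert z B) \<mu>"
proof -
  have "invol_on {z, \<mu> z} \<mu>" using assms invol by (auto simp: link_def invol_on_def)
  moreover have "insert z B = (B - {\<mu> z}) \<union> {z, \<mu> z}" using assms by (auto simp: link_def)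
  ultimately show ?thesis using assms invol_on_Un by (metis link_def)
qed

lemma chain_appendD: "chain (xs @ ys) \<Longrightarrow> chain xs \<and> chain ys \<and> covered xs \<inter> covered ys = {}"
proof (induction xs rule: chain.induct)
  case (2 z B xs)
  then show ?case by (cases xs) auto
qed auto

lemma chain_subset: "chain xs \<Longrightarrow> covered xs \<subseteq> V"
  by (induction xs rule: chain.induct) (auto simp: link_def)

lemma chain_invol: "chain xs \<Longrightarrow> invol_on (covered xs) \<mu>"
  by (induction xs rule: chain.induct) (auto simp: invol_on_def dest!: link_invol)

lemma chain_base_notin_outer: "chain xs \<Longrightarrow> xs \<noteq> [] \<Longrightarrow> fst (last xs) \<in> covered xs - outer xs"
proof (induction xs rule: chain.induct)
  case (2 z B xs)
  then show ?case
    using outer_subset[of xs] by (cases "xs = []") (auto simp: link_def)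
qed auto

text \<open>Matching edges are shifted along the chain. The blossom of \<open>v\<close> is matched
  without \<open>v\<close>, its base is rematched to a neighbour in the next blossom, and so on
  until the last base is left over. Links before the blossom of \<open>v\<close> keep
  \<open>\<mu>\<close>.\<close>

lemma chain_shift:
  "chain xs \<Longrightarrow> v \<in> outer xs \<Longrightarrow> pm (covered xs - {fst (last xs), v})"
proof (induction xs arbitrary: v rule: chain.induct)
  case (2 z B xs)
  show ?case
  proof (cases "xs = []")
    case True
    then have "covered ((z, B) # xs) - {fst (last ((z, B) # xs)), v} = B - {v}"
      using 2(2) by (auto simp: link_def)
    then show ?thesis using 2(2,3) True by (auto simp: link_def)
  next
    case False
    let ?z = "fst (last xs)"
    have l: "fst (last ((z, B) # xs)) = ?z" using False by simp
    have ch: "chain xs" "link z B" "insert z B \<inter> covered xs = {}" using 2(2) by auto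
    have base: "?z \<in> covered xs - outer xs" using chain_base_notin_outer ch(1) False by blast
    show ?thesis
    proof (cases "v \<in> B")
      case True
      obtain u where u: "u \<in> snd (hd xs)" "A u z" using 2(2) False by auto
      have uo: "u \<in> outer xs" using u(1) False by (cases xs) (auto simp: outer_def)
      have "pm ((B - {v}) \<union> {u, z})"
        using ch True uo outer_subset[of xs] pm_pair[OF u(2)] by (intro pm_Un) (auto simp: link_def)
      moreover have "((B - {v}) \<union> {u, z}) \<inter> (covered xs - {?z, u}) = {}" using ch by auto
      ultimately have "pm (((B - {v}) \<union> {u, z}) \<union> (covered xs - {?z, u}))"
        using 2(1)[OF ch(1) uo] pm_Un by blast
      moreover have "((B - {v}) \<union> {u, z}) \<union> (covered xs - {?z, u}) =
          covered ((z, B) # xs) - {?z, v}"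
        using ch uo outer_subset[of xs] base True by (auto simp: link_def)
      ultimately show ?thesis using l by simp
    next
      case False
      then have vo: "v \<in> outer xs" using 2(3) by simp
      have "pm (insert z B \<union> (covered xs - {?z, v}))"
        using ch 2(1)[OF ch(1) vo] pm_\<mu>[OF link_invol[OF ch(2)]] by (intro pm_Un) auto
      moreover have "insert z B \<union> (covered xs - {?z, v}) = covered ((z, B) # xs) - {?z, v}"
        using ch vo outer_subset[of xs] base by auto
      ultimately show ?thesis using l by simp
    qed
  qed
qed simp

end

text \<open>A set closed under \<open>\<mu>\<close> and matched by \<open>A\<close>-edges through
  \<open>\<tau>\<close> would be a union of alternating circuits, so the assumption says that
  \<open>\<mu>\<close> is the only perfect matching. With \<open>\<tau> = \<mu>\<close> it also
  excludes edges parallel to matching edges.\<close>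

locale uniquely_matched_graph = matched_graph +
  assumes no_alternating:
    "S \<subseteq> V \<Longrightarrow> S \<noteq> {} \<Longrightarrow> invol_on S \<mu> \<Longrightarrow> invol_on S \<tau> \<Longrightarrow> \<exists>v\<in>S. \<not> A v (\<tau> v)"
begin

text \<open>The vertices that \<open>\<nu>\<close> matches along \<open>A\<close> form a set closed
  under \<open>\<mu>\<close>, since a vertex matched along \<open>\<mu>\<close> shares that edge
  with its mate. Then \<open>no_alternating\<close> applies to this set.\<close>

lemma unique_matching:
  assumes "X \<subseteq> V" "invol_on X \<mu>" "invol_on X \<nu>" "\<And>v. v \<in> X \<Longrightarrow> A v (\<nu> v) \<or> \<nu> v = \<mu> v" "v \<in> X"
  shows "\<not> A v (\<nu> v)"
proof
  assume Av: "A v (\<nu> v)"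
  let ?S = "{v \<in> X. A v (\<nu> v)}"
  have "invol_on ?S \<nu>" using assms(3) A_sym by (auto simp: invol_on_def)
  moreover have "invol_on ?S \<mu>"
  proof -
    have "A (\<mu> w) (\<nu> (\<mu> w))" if "w \<in> ?S" for w
    proof (rule ccontr)
      assume n: "\<not> ?thesis"
      have w: "w \<in> X" "\<mu> w \<in> X" "\<mu> (\<mu> w) = w" using that assms(2) by (auto simp: invol_on_def)
      then have "\<nu> (\<mu> w) = w" using n assms(4)[of "\<mu> w"] by simp
      then have "\<nu> w = \<mu> w" using assms(3) w by (metis invol_onD(2))
      with that n \<open>\<nu> (\<mu> w) = w\<close> show False using A_sym by auto
    qed
    then show ?thesis using assms(2) by (auto simp: invol_on_def)
  qed
  ultimately show False using no_alternating[of ?S \<nu>] assms(1,5) Av by blast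
qed

text \<open>Shifting from \<open>u\<close> leaves exactly \<open>u\<close> and the last base
  unmatched. The edge between them would complete a second perfect matching of the covered
  set.\<close>

lemma chain_no_circuit:
  assumes "chain xs" "xs \<noteq> []" "u \<in> snd (hd xs)" "A u (fst (last xs))"
  shows False
proof -
  let ?z = "fst (last xs)"
  have uo: "u \<in> outer xs" using assms(2,3) by (cases xs) (auto simp: outer_def)
  obtain \<nu> where \<nu>: "invol_on (covered xs - {?z, u}) \<nu>"
    "\<forall>v\<in>covered xs - {?z, u}. A v (\<nu> v) \<or> \<nu> v = \<mu> v"
    using chain_shift[OF assms(1) uo] unfolding pm_def by auto
  let ?\<nu> = "\<lambda>v. if v = u then ?z else if v = ?z then u else \<nu> v"
  have z: "?z \<in> covered xs" "?z \<noteq> u" "u \<in> covered xs"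
    using chain_base_notin_outer[OF assms(1,2)] uo outer_subset by auto
  have "invol_on (covered xs) ?\<nu>" using \<nu>(1) z by (auto simp: invol_on_def)
  moreover have "A v (?\<nu> v) \<or> ?\<nu> v = \<mu> v" if "v \<in> covered xs" for v
    using \<nu>(2) that assms(4) A_sym by auto
  ultimately have "\<not> A u (?\<nu> u)"
    using unique_matching[of "covered xs" ?\<nu> u] chain_subset chain_invol assms(1) z(3) by blast
  then show False using assms(4) by simp
qed

text \<open>An edge from the first blossom to a later blossom \<open>B\<close> closes an odd
  alternating circuit through the links in between. These links and \<open>B\<close> together are
  again factor-critical, so they form one larger blossom at \<open>z\<close>.\<close>

lemma chain_merge:
  assumes ch: "chain (xs @ (z, B) # ys)" and xs: "xs \<noteq> []" "u \<in> snd (hd xs)" and w: "w \<in> B" "A u w"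
  shows "chain ((z, B \<union> covered xs) # ys)"
proof -
  have ch': "chain xs" "chain ((z, B) # ys)" "covered xs \<inter> covered ((z, B) # ys) = {}"
    "chain (xs @ [(z, B)])"
    using chain_appendD[of xs "(z, B) # ys"] chain_appendD[of "xs @ [(z, B)]" ys] ch by auto
  have l: "link z B" using ch'(2) by auto
  have inv: "invol_on (covered xs) \<mu>" using chain_invol ch'(1) by blast
  have z: "z \<notin> covered xs" "B \<inter> covered xs = {}" using ch'(3) by auto
  have "pm (B \<union> covered xs - {v})" if v: "v \<in> B \<union> covered xs" for v
  proof -
    consider "v \<in> B" | "v \<in> outer xs" | "v \<in> covered xs" "v \<notin> outer xs" using v by blast
    then show ?thesis
    proof cases
      case 1
      then have "pm ((B - {v}) \<union> covered xs)"
        using l pm_\<mu>[OF inv] z by (intro pm_Un) (auto simp: link_def)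
      moreover have "(B - {v}) \<union> covered xs = B \<union> covered xs - {v}" using 1 z by auto
      ultimately show ?thesis by simp
    next
      case 2
      then have "pm (covered (xs @ [(z, B)]) - {z, v})" using chain_shift[OF ch'(4), of v] by simp
      moreover have "covered (xs @ [(z, B)]) - {z, v} = B \<union> covered xs - {v}"
        using z l by (auto simp: link_def)
      ultimately show ?thesis by simp
    next
      \<comment> \<open>Here \<open>v\<close> is a base. The chain ending at \<open>v\<close> is
        shifted from \<open>u\<close>, which is matched to \<open>w\<close>; \<open>B\<close> is
        matched without \<open>w\<close>, and the links after \<open>v\<close> keep
        \<open>\<mu>\<close>.\<close>
      case 3
      then obtain B' where "(v, B') \<in> set xs" by (auto simp: covered_def outer_def)
      then obtain xs1 xs2 where xs12: "xs = (xs1 @ [(v, B')]) @ xs2"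
        by (metis append.assoc append_Cons append_Nil in_set_conv_decomp)
      let ?xs = "xs1 @ [(v, B')]"
      have c1: "chain ?xs" "chain xs2" "covered ?xs \<inter> covered xs2 = {}"
        using chain_appendD[of ?xs xs2] ch'(1) xs12 by auto
      have u1: "u \<in> snd (hd ?xs)" using xs(2) xs12 by (cases xs1) auto
      then have uo: "u \<in> outer ?xs" by (cases xs1) auto
      have v1: "v \<notin> outer ?xs" "v \<in> covered ?xs" using chain_base_notin_outer[OF c1(1)] by auto
      have pm1: "pm (covered ?xs - {v, u})" using chain_shift[OF c1(1) uo] by simp
      have uw: "u \<in> covered ?xs" "w \<notin> covered xs" using uo outer_subset w(1) z by auto
      have cov: "covered xs = covered ?xs \<union> covered xs2" using xs12 by auto
      have "pm ((B - {w}) \<union> covered xs2)"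
        using l w(1) pm_\<mu>[OF chain_invol[OF c1(2)]] z(2) cov
        by (intro pm_Un) (auto simp: link_def)
      moreover have "pm ((covered ?xs - {v, u}) \<union> {u, w})"
        using pm1 pm_pair[OF w(2)] uw cov by (intro pm_Un) auto
      moreover have "((B - {w}) \<union> covered xs2) \<inter> ((covered ?xs - {v, u}) \<union> {u, w}) = {}"
        using z(2) cov c1(3) uw by blast
      ultimately have "pm (((B - {w}) \<union> covered xs2) \<union> ((covered ?xs - {v, u}) \<union> {u, w}))"
        using pm_Un by blast
      moreover have "((B - {w}) \<union> covered xs2) \<union> ((covered ?xs - {v, u}) \<union> {u, w}) =
          B \<union> covered xs - {v}"
        using cov w(1) uw uo v1 z(2) c1(3) by blast
      ultimately show ?thesis by simp
    qed
  qed
  moreover have "invol_on (B \<union> covered xs - {\<mu> z}) \<mu>"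
  proof -
    have "B \<union> covered xs - {\<mu> z} = (B - {\<mu> z}) \<union> covered xs" using l z by (auto simp: link_def)
    then show ?thesis using invol_on_Un l inv by (metis link_def)
  qed
  ultimately have "link z (B \<union> covered xs)"
    using l z chain_subset[OF ch'(1)] by (auto simp: link_def)
  then show ?thesis using ch'(2,3) by auto
qed

text \<open>This is Kotzig's theorem: as \<open>B - {r}\<close> is closed under
  \<open>\<mu>\<close>, the matching edge at \<open>r\<close> is the only edge between
  \<open>B\<close> and the rest of \<open>V\<close>, hence a bridge.\<close>

theorem matching_bridge:
  assumes "V \<noteq> {}"
  obtains B r where "B \<subseteq> V" "r \<in> B" "\<mu> r \<in> V - B" "invol_on (B - {r}) \<mu>"
    "\<And>v w. v \<in> B \<Longrightarrow> w \<in> V \<Longrightarrow> A v w \<Longrightarrow> w \<in> B"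
proof -
  obtain r where r: "r \<in> V" using assms by blast
  let ?C = "\<lambda>xs. chain xs \<and> xs \<noteq> []"
  \<comment> \<open>A single matching edge with a one-vertex blossom is a chain, so the extremal
    choice below is possible.\<close>
  have "?C [(\<mu> r, {r})]"
    using r invol no_fixed pm_\<mu>[of "{}"] by (auto simp: link_def invol_on_def)
  moreover have "\<forall>xs. ?C xs \<longrightarrow> card (covered xs) < Suc (card V)"
    using chain_subset finite_V by (simp add: card_mono less_Suc_eq_le)
  ultimately obtain xs0 where xs0: "?C xs0" "\<And>ys. ?C ys \<Longrightarrow> card (covered ys) \<le> card (covered xs0)"
    using ex_has_greatest_nat[of ?C _ "\<lambda>xs. card (covered xs)"] by blast
  let ?D = "\<lambda>xs. ?C xs \<and> card (covered xs) = card (covered xs0)"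
  obtain xs where xs: "?D xs" "\<And>ys. ?D ys \<Longrightarrow> length xs \<le> length ys"
    using ex_has_least_nat[of ?D xs0 length] xs0(1) by blast
  obtain z B ys where xs_eq: "xs = (z, B) # ys" using xs(1) by (cases xs) auto
  have ch: "chain xs" and l: "link z B" using xs(1) xs_eq by auto
  have closed: "w \<in> B" if v: "v \<in> B" "w \<in> V" "A v w" for v w
  proof (rule ccontr)
    assume wB: "w \<notin> B"
    consider "w \<notin> covered xs" | "w \<in> covered xs - outer xs" | "w \<in> outer xs"
      using outer_subset by blast
    then show False
    proof cases
      \<comment> \<open>An uncovered neighbour of the first blossom can be prepended as a new base,
        contradicting the maximal size.\<close>
      case 1
      have inv: "invol_on (covered xs) \<mu>" using ch chain_invol by blast
      have mw: "\<mu> w \<notin> covered xs" "\<mu> w \<in> V" "\<mu> (\<mu> w) = w"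
        using 1 inv invol that(2) by (auto simp: invol_on_def)
      have "link w {\<mu> w}" using mw that(2) no_fixed[OF that(2)] pm_\<mu>[of "{}"]
        by (auto simp: link_def invol_on_def)
      then have "?C ((w, {\<mu> w}) # xs)" using ch 1 mw xs_eq v by auto
      then have "card (covered ((w, {\<mu> w}) # xs)) \<le> card (covered xs)" using xs0(2) xs(1) by metis
      moreover have "covered xs \<subset> covered ((w, {\<mu> w}) # xs)" using 1 by auto
      moreover have "finite (covered ((w, {\<mu> w}) # xs))"
        using chain_subset[OF ch] finite_V finite_subset by auto
      ultimately show False using psubset_card_mono by (metis leD)
    next
      \<comment> \<open>A base adjacent to the first blossom closes up the initial segment of the
        chain that ends at this base.\<close>
      case 2
      then obtain B' where "(w, B') \<in> set xs" by (auto simp: covered_def outer_def)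
      then obtain xs1 xs2 where xs12: "xs = (xs1 @ [(w, B')]) @ xs2"
        by (metis append.assoc append_Cons append_Nil in_set_conv_decomp)
      have "chain (xs1 @ [(w, B')])" using chain_appendD ch xs12 by blast
      moreover have "v \<in> snd (hd (xs1 @ [(w, B')]))" using xs12 xs_eq v by (cases xs1) auto
      ultimately show False using chain_no_circuit[of "xs1 @ [(w, B')]" v] v(3) by simp
    next
      \<comment> \<open>Merging keeps the covered set but drops at least one link, contradicting the
        minimal length.\<close>
      case 3
      then obtain z' B' where B': "(z', B') \<in> set ys" "w \<in> B'" using wB xs_eq by (auto simp: outer_def)
      then obtain ys1 ys2 where ys12: "ys = ys1 @ (z', B') # ys2" by (meson split_list)
      let ?xs1 = "(z, B) # ys1"
      have eq: "xs = ?xs1 @ (z', B') # ys2" using ys12 xs_eq by simp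
      have "chain ((z', B' \<union> covered ?xs1) # ys2)"
        using chain_merge[of ?xs1 z' B' ys2 v w] ch eq v B' by simp
      moreover have "covered ((z', B' \<union> covered ?xs1) # ys2) = covered xs" using eq by auto
      ultimately have "length xs \<le> length ((z', B' \<union> covered ?xs1) # ys2)"
        using xs by (metis list.distinct(1))
      then show False using eq by simp
    qed
  qed
  have "\<mu> (\<mu> z) = z" using l invol by (auto simp: link_def invol_on_def)
  then show thesis using that[of B "\<mu> z"] l closed by (auto simp: link_def)
qed

end

section \<open>Covering an odd circuit\<close>

fun arcs :: "'v list \<Rightarrow> ('v \<times> 'v) set" where
  "arcs (x # y # zs) = insert (x, y) (arcs (y # zs))"
| "arcs _ = {}"

definition cyc :: "'v list \<Rightarrow> ('v \<times> 'v) set" where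
  "cyc xs = arcs (xs @ [hd xs])"

lemma arcs_append:
  "xs \<noteq> [] \<Longrightarrow> ys \<noteq> [] \<Longrightarrow> arcs (xs @ ys) = arcs xs \<union> {(last xs, hd ys)} \<union> arcs ys"
proof (induction xs rule: arcs.induct)
  case ("2_2" x)
  then show ?case by (cases ys) auto
qed auto

lemma arcs_Cons: "xs \<noteq> [] \<Longrightarrow> arcs (x # xs) = insert (x, hd xs) (arcs xs)"
  by (cases xs) auto

lemma arcs_sub: "(u, v) \<in> arcs xs \<Longrightarrow> u \<in> set xs \<and> v \<in> set xs"
  by (induction xs rule: arcs.induct) auto

lemma arcs_ends:
  "distinct xs \<Longrightarrow> (u, v) \<in> arcs xs \<Longrightarrow> u \<noteq> last xs \<and> v \<noteq> hd xs \<and> u \<noteq> v"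
  by (induction xs rule: arcs.induct) (auto dest: arcs_sub)

lemma cyc_rotate: "cyc (xs @ ys) = cyc (ys @ xs)"
proof (cases "xs = [] \<or> ys = []")
  case False
  then have "cyc (xs @ ys) = arcs xs \<union> {(last xs, hd ys)} \<union> (arcs ys \<union> {(last ys, hd xs)})"
    "cyc (ys @ xs) = arcs ys \<union> {(last ys, hd xs)} \<union> (arcs xs \<union> {(last xs, hd ys)})"
    unfolding cyc_def by (simp_all add: arcs_append)
  then show ?thesis by auto
qed auto

fun pairing :: "'v list \<Rightarrow> 'v \<Rightarrow> 'v" where
  "pairing (x # y # zs) = (pairing zs)(x := y, y := x)"
| "pairing _ = id"

lemma pairing_notin: "v \<notin> set xs \<Longrightarrow> pairing xs v = v"
  by (induction xs rule: pairing.induct) auto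

lemma pairing_invol: "distinct xs \<Longrightarrow> invol_on (set xs) (pairing xs)"
proof (induction xs rule: pairing.induct)
  case (1 x y zs)
  then have "invol_on (set zs) (pairing zs)" by simp
  then show ?case using 1(2) by (auto simp: invol_on_def)
qed (auto simp: invol_on_def)

lemma pairing_arcs:
  "distinct xs \<Longrightarrow> even (length xs) \<Longrightarrow> v \<in> set xs \<Longrightarrow>
    (v, pairing xs v) \<in> arcs xs \<or> (pairing xs v, v) \<in> arcs xs"
proof (induction xs rule: pairing.induct)
  case (1 x y zs)
  show ?case
  proof (cases "v \<in> {x, y}")
    case False
    then have "(v, pairing zs v) \<in> arcs zs \<or> (pairing zs v, v) \<in> arcs zs" using 1 by auto
    moreover have "arcs zs \<subseteq> arcs (x # y # zs)" by (cases zs) auto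
    ultimately show ?thesis using False by auto
  qed auto
qed auto

lemma pairing_no_fixed:
  "distinct xs \<Longrightarrow> even (length xs) \<Longrightarrow> v \<in> set xs \<Longrightarrow> pairing xs v \<noteq> v"
  using pairing_arcs arcs_ends by fastforce

lemma pairing_snoc: "even (length xs) \<Longrightarrow> pairing (xs @ [z]) = pairing xs"
  by (induction xs rule: pairing.induct) auto

text \<open>The pairings that start at the first and at the second entry are the two alternating
  matchings of the path, so every arc lies in one of them.\<close>

lemma arcs_pairing:
  "distinct (x # xs) \<Longrightarrow> (u, v) \<in> arcs (x # xs) \<Longrightarrow> pairing (x # xs) u = v \<or> pairing xs u = v"
proof (induction xs arbitrary: x)
  case (Cons y ys)
  show ?case
  proof (cases "(u, v) = (x, y)")
    case False
    then have uv: "(u, v) \<in> arcs (y # ys)" using Cons.prems by auto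
    then consider "pairing (y # ys) u = v" | "pairing ys u = v" using Cons by auto
    then show ?thesis
    proof cases
      case 2
      have "u \<noteq> v" "u \<noteq> x" using uv Cons.prems(1) arcs_ends[of "y # ys"] arcs_sub[OF uv] by auto
      moreover have "u \<noteq> y" using 2 Cons.prems(1) pairing_notin[of y ys] \<open>u \<noteq> v\<close> by auto
      ultimately show ?thesis using 2 by simp
    qed simp
  qed simp
qed simp

text \<open>
  \<open>V\<close> and \<open>E\<close> are the vertices and arcs of a circuit, \<open>X\<close> its crossing vertices, and \<open>\<mu>\<close> the chords
  between the other vertices. The condition on \<open>E\<close> in a triple cover mentions only one direction, which is
  enough as the \<open>\<nu> z\<close> are involutions.
\<close>
definition near_matching ::
  "'v set \<Rightarrow> ('v \<times> 'v) set \<Rightarrow> 'v set \<Rightarrow> ('v \<Rightarrow> 'v) \<Rightarrow> 'v \<Rightarrow> ('v \<Rightarrow> 'v) \<Rightarrow> bool" where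
  "near_matching V E X \<mu> x \<nu> \<longleftrightarrow> x \<in> V \<and> \<nu> x = x \<and> invol_on V \<nu> \<and>
     (\<forall>v\<in>V - {x}. (v, \<nu> v) \<in> E \<or> (\<nu> v, v) \<in> E \<or> v \<notin> X \<and> \<nu> v = \<mu> v)"

definition triple_cover ::
  "'v set \<Rightarrow> ('v \<times> 'v) set \<Rightarrow> 'v set \<Rightarrow> ('v \<Rightarrow> 'v) \<Rightarrow> 'v set \<Rightarrow> bool" where
  "triple_cover V E X \<mu> K \<longleftrightarrow> (\<exists>\<nu>. (\<forall>z\<in>K. near_matching V E X \<mu> z (\<nu> z)) \<and>
     (\<forall>(u, v)\<in>E. \<exists>z\<in>K. \<nu> z u = v))"

text \<open>
  \<open>P\<close> and \<open>Q\<close> are the open arcs between \<open>i\<close> and \<open>j\<close>, and \<open>\<mu> x = y\<close> is the only chord between them. The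
  component \<open>Y\<close> of \<open>y\<close> in the union of \<open>f\<close> and \<open>\<mu>\<close> ends at \<open>t\<close>; flipping along it decides
  which vertices of \<open>Q\<close> are matched by \<open>f\<close> and which by chords.
\<close>
lemma triple_cover_core:
  assumes V: "V = insert i (insert j (P \<union> Q))" "i \<noteq> j" "i \<notin> P \<union> Q" "j \<notin> P \<union> Q" "P \<inter> Q = {}"
    and E: "\<And>u v. (u, v) \<in> E \<Longrightarrow> u \<in> insert i P \<and> ei u = v \<or> u \<in> insert j P \<and> ej u = v \<or>
        u \<in> insert i (insert j Q) \<and> f u = v \<or> u \<in> Q \<and> w u = v"
    and ei: "invol_on (insert i P) ei" "\<And>v. v \<in> insert i P \<Longrightarrow> (v, ei v) \<in> E \<or> (ei v, v) \<in> E"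
    and ej: "invol_on (insert j P) ej" "\<And>v. v \<in> insert j P \<Longrightarrow> (v, ej v) \<in> E \<or> (ej v, v) \<in> E"
    and f: "invol_on (insert i (insert j Q)) f"
      "\<And>v. v \<in> insert i (insert j Q) \<Longrightarrow> (v, f v) \<in> E \<or> (f v, v) \<in> E"
    and w: "invol_on Q w" "\<And>v. v \<in> Q \<Longrightarrow> (v, w v) \<in> E \<or> (w v, v) \<in> E"
    and xy: "x \<in> P" "y \<in> Q" "\<mu> x = y" "\<mu> y = x" "invol_on (P - {x}) \<mu>"
    and k: "k \<in> Q" "k \<noteq> y" "V \<inter> X = {i, j, k}" "invol_on (Q - {k, y}) \<mu>"
    and Y: "Y \<subseteq> insert i (insert j Q)" "y \<in> Y" "invol_on Y f" "invol_on (Y - {y, t}) \<mu>"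
      "Y \<inter> {i, j, k} = {t}"
    and t: "{t, t'} = {j, k}"
  shows "triple_cover V E X \<mu> {i, j, k}"
proof -
  let ?R = "insert i (insert j Q) - Y"
  have tt: "t \<noteq> t'" "t \<noteq> i" "t' \<noteq> i" "t \<in> Y" "t' \<notin> Y" "i \<notin> Y" "y \<noteq> t" "y \<noteq> t'"
    "t \<in> insert j Q" "t' \<in> insert j Q" "t \<notin> P" "t' \<notin> P" "t \<in> V" "t' \<in> V" "t \<in> X" "t' \<in> X"
    using t Y(5) V k xy(2) by (auto simp: doubleton_eq_iff)
  have R: "invol_on ?R f" using f(1) Y(3) invol_on_Diff by blast
  have R\<mu>: "invol_on (?R - {i, t'}) \<mu>"
  proof -
    have "?R - {i, t'} = (Q - {k, y}) - (Y - {y, t})"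
      using t tt V Y(2) k xy by (auto simp: doubleton_eq_iff)
    then show ?thesis using invol_on_Diff[OF k(4) Y(4)] by simp
  qed
  \<comment> \<open>One matching for each missing vertex. \<open>\<nu>i\<close> uses circuit edges
    only. \<open>\<nu>t\<close> uses the chord from \<open>x\<close> to \<open>y\<close> and all
    chords within \<open>P\<close> and \<open>Y\<close>, and circuit edges elsewhere.
    \<open>\<nu>t'\<close> uses circuit edges on \<open>insert i P\<close> and \<open>Y\<close>, and
    chords on the rest.\<close>
  define \<nu>i where "\<nu>i = (\<lambda>v. if v \<in> insert j P then ej v else if v \<in> Q then w v else v)"
  define \<nu>t where "\<nu>t = (\<lambda>v. if v = t then t else if v \<in> P \<union> Y then \<mu> v else f v)"
  define \<nu>t' where "\<nu>t' = (\<lambda>v. if v = t' then t' else if v \<in> insert i P then ei v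
    else if v \<in> Y then f v else \<mu> v)"
  have free: "v \<notin> X" if "v \<in> V" "v \<noteq> i" "v \<noteq> t" "v \<noteq> t'" for v
    using that k(3) t by (auto simp: doubleton_eq_iff)
  have Ysub: "Y \<subseteq> insert j Q" using Y(1) tt by blast
  have YV: "Y \<subseteq> V" using Ysub V(1) by blast
  have PY: "P \<inter> Y = {}" using Y(1) V by blast
  have inv\<mu>: "invol_on (P \<union> Y - {t}) \<mu>"
  proof -
    have "invol_on {x, y} \<mu>" using xy by (auto simp: invol_on_def)
    then have "invol_on ((P - {x}) \<union> (Y - {y, t}) \<union> {x, y}) \<mu>"
      using xy(5) Y(4) invol_on_Un by blast
    moreover have "(P - {x}) \<union> (Y - {y, t}) \<union> {x, y} = P \<union> Y - {t}"
      using xy(1) Y(2) tt by blast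
    ultimately show ?thesis by simp
  qed
  have "near_matching V E X \<mu> i \<nu>i"
    unfolding near_matching_def
  proof (intro conjI ballI)
    show "invol_on V \<nu>i"
      unfolding invol_on_def
    proof (intro ballI)
      fix v assume "v \<in> V"
      then consider "v = i" | "v \<in> insert j P" | "v \<in> Q" using V(1) by blast
      then show "\<nu>i v \<in> V \<and> \<nu>i (\<nu>i v) = v"
      proof cases
        case 2
        then show ?thesis using invol_onD[OF ej(1) 2] V(1) by (auto simp: \<nu>i_def)
      next
        case 3
        then have "w v \<in> Q" "w (w v) = v" "v \<notin> insert j P" "w v \<notin> insert j P"
          using invol_onD[OF w(1) 3] V by auto
        then show ?thesis using V(1) 3 by (simp add: \<nu>i_def)
      qed (use V in \<open>auto simp: \<nu>i_def\<close>)
    qed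
    fix v assume "v \<in> V - {i}"
    then show "(v, \<nu>i v) \<in> E \<or> (\<nu>i v, v) \<in> E \<or> v \<notin> X \<and> \<nu>i v = \<mu> v"
      using V(1) ej(2)[of v] w(2)[of v] by (auto simp: \<nu>i_def)
  qed (use V in \<open>auto simp: \<nu>i_def\<close>)
  moreover have "near_matching V E X \<mu> t \<nu>t"
    unfolding near_matching_def
  proof (intro conjI ballI)
    show "invol_on V \<nu>t"
      unfolding invol_on_def
    proof (intro ballI)
      fix v assume "v \<in> V"
      then consider "v = t" | "v \<in> P \<union> Y - {t}" | "v \<in> ?R" using V(1) by blast
      then show "\<nu>t v \<in> V \<and> \<nu>t (\<nu>t v) = v"
      proof cases
        case 2
        have "\<mu> v \<in> P \<union> Y - {t}" "\<mu> (\<mu> v) = v" using invol_onD[OF inv\<mu> 2] by auto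
        then show ?thesis using 2 YV V(1) by (auto simp: \<nu>t_def)
      next
        case 3
        have "f v \<in> ?R" "f (f v) = v" using invol_onD[OF R 3] by auto
        moreover have "v \<notin> P \<union> Y" "v \<noteq> t" if "v \<in> ?R" for v using that V tt by auto
        ultimately show ?thesis using 3 V(1) by (auto simp: \<nu>t_def)
      qed (use tt in \<open>auto simp: \<nu>t_def\<close>)
    qed
    fix v assume v: "v \<in> V - {t}"
    show "(v, \<nu>t v) \<in> E \<or> (\<nu>t v, v) \<in> E \<or> v \<notin> X \<and> \<nu>t v = \<mu> v"
    proof (cases "v \<in> P \<union> Y")
      case True
      then have "v \<noteq> i" "v \<noteq> t'" using tt V by auto
      then show ?thesis using True v free[of v] by (auto simp: \<nu>t_def)
    next
      case False
      then show ?thesis using v V(1) f(2)[of v] by (auto simp: \<nu>t_def)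
    qed
  qed (use tt in \<open>auto simp: \<nu>t_def\<close>)
  moreover have "near_matching V E X \<mu> t' \<nu>t'"
    unfolding near_matching_def
  proof (intro conjI ballI)
    show "invol_on V \<nu>t'"
      unfolding invol_on_def
    proof (intro ballI)
      fix v assume "v \<in> V"
      then consider "v = t'" | "v \<in> insert i P" | "v \<in> Y" | "v \<in> ?R - {i, t'}" using V(1) by blast
      then show "\<nu>t' v \<in> V \<and> \<nu>t' (\<nu>t' v) = v"
      proof cases
        case 2
        have "ei v \<in> insert i P" "ei (ei v) = v" using invol_onD[OF ei(1) 2] by auto
        moreover have "v \<noteq> t'" if "v \<in> insert i P" for v using that tt by auto
        ultimately show ?thesis using 2 V(1) by (auto simp: \<nu>t'_def)
      next
        case 3
        have "f v \<in> Y" "f (f v) = v" using invol_onD[OF Y(3) 3] by auto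
        moreover have "v \<noteq> t'" "v \<notin> insert i P" if "v \<in> Y" for v using that tt PY by auto
        ultimately show ?thesis using 3 YV by (auto simp: \<nu>t'_def)
      next
        case 4
        have \<mu>v: "\<mu> v \<in> ?R - {i, t'}" "\<mu> (\<mu> v) = v" using invol_onD[OF R\<mu> 4] by auto
        have out: "u \<noteq> t'" "u \<notin> insert i P" "u \<notin> Y" "u \<in> V" if "u \<in> ?R - {i, t'}" for u
          using that V by auto
        then have "\<nu>t' u = \<mu> u" if "u \<in> ?R - {i, t'}" for u
          using that unfolding \<nu>t'_def by (simp only: if_False)
        then show ?thesis using \<mu>v 4 out(4) by metis
      qed (use tt in \<open>auto simp: \<nu>t'_def\<close>)
    qed
    fix v assume v: "v \<in> V - {t'}"
    consider "v \<in> insert i P" | "v \<in> Y" "v \<notin> insert i P" | "v \<notin> insert i P" "v \<notin> Y" by blast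
    then show "(v, \<nu>t' v) \<in> E \<or> (\<nu>t' v, v) \<in> E \<or> v \<notin> X \<and> \<nu>t' v = \<mu> v"
    proof cases
      case 1
      then show ?thesis using ei(2)[of v] v by (auto simp: \<nu>t'_def)
    next
      case 2
      then show ?thesis using f(2)[of v] v Y(1) by (auto simp: \<nu>t'_def)
    next
      case 3
      then have "v \<noteq> t" "v \<noteq> i" using tt by auto
      then show ?thesis using 3 v free[of v] by (auto simp: \<nu>t'_def)
    qed
  qed (use tt in \<open>auto simp: \<nu>t'_def\<close>)
  \<comment> \<open>Arcs of \<open>ei\<close> lie in \<open>\<nu>t'\<close>, those of
    \<open>ej\<close> and \<open>w\<close> in \<open>\<nu>i\<close>, and those of \<open>f\<close>
    in \<open>\<nu>t'\<close> or \<open>\<nu>t\<close> according to whether they are in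
    \<open>Y\<close>.\<close>
  moreover have "\<nu>i u = v \<or> \<nu>t u = v \<or> \<nu>t' u = v" if uv: "(u, v) \<in> E" for u v
  proof -
    consider "u \<in> insert i P" "ei u = v" | "u \<in> insert j P" "ej u = v"
      | "u \<in> insert i (insert j Q)" "f u = v" | "u \<in> Q" "w u = v"
      using E[OF uv] by blast
    then show ?thesis
    proof cases
      case 1
      moreover have "u \<noteq> t'" using 1 tt by auto
      ultimately show ?thesis by (auto simp: \<nu>t'_def)
    next
      case 3
      show ?thesis
      proof (cases "u \<in> Y")
        case True
        moreover have "u \<noteq> t'" "u \<notin> insert i P" using True tt PY by auto
        ultimately show ?thesis using 3 by (simp add: \<nu>t'_def)
      next
        case False
        moreover have "u \<noteq> t" "u \<notin> P" using False tt 3 V by auto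
        ultimately show ?thesis using 3 by (simp add: \<nu>t_def)
      qed
    next
      case 4
      then have "u \<notin> insert j P" using V by auto
      then show ?thesis using 4 by (simp add: \<nu>i_def)
    qed (simp add: \<nu>i_def)
  qed
  ultimately have "\<exists>\<nu>. (\<forall>z\<in>{i, t, t'}. near_matching V E X \<mu> z (\<nu> z)) \<and>
      (\<forall>(u, v)\<in>E. \<exists>z\<in>{i, t, t'}. \<nu> z u = v)"
    using tt by (intro exI[of _ "(\<lambda>_. \<nu>t')(i := \<nu>i, t := \<nu>t)"]) auto
  moreover have "{i, t, t'} = {i, j, k}" using t by auto
  ultimately show ?thesis unfolding triple_cover_def by simp
qed

lemma invol_on_cong: "invol_on S f \<Longrightarrow> (\<And>v. v \<in> S \<Longrightarrow> f v = g v) \<Longrightarrow> invol_on S g"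
  unfolding invol_on_def by metis

text \<open>Chords match \<open>P\<close> apart from \<open>x\<close>, so \<open>P\<close> has odd
  and \<open>Q\<close> even length. This parity provides the alternating matchings that
  \<open>triple_cover_core\<close> asks for; it remains to construct \<open>Y\<close>.\<close>

lemma triple_cover_single_chord:
  assumes dist: "distinct (i # P @ j # Q)" and odd_n: "odd (length (i # P @ j # Q))"
    and X: "X \<inter> set (i # P @ j # Q) = {i, j, k}" and k: "k \<in> set Q" "\<mu> x \<noteq> k"
    and x: "x \<in> set P" "\<mu> x \<in> set Q" "\<mu> (\<mu> x) = x"
    and inv: "invol_on (set P - {x}) \<mu>" "invol_on (set Q - {k, \<mu> x}) \<mu>"
    and nf: "\<And>v. v \<in> set (P @ Q) - {k} \<Longrightarrow> \<mu> v \<noteq> v"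
  shows "triple_cover (set (i # P @ j # Q)) (cyc (i # P @ j # Q)) X \<mu> {i, j, k}"
proof -
  let ?L = "i # P @ j # Q" and ?y = "\<mu> x"
  let ?E = "cyc ?L"
  let ?W = "insert i (insert j (set Q))"
  have kP: "k \<notin> set P" using k(1) dist by auto
  have nfP: "\<mu> v \<noteq> v" if "v \<in> set P - {x}" for v
  proof -
    have "v \<in> set (P @ Q) - {k}" using that kP by auto
    then show ?thesis by (rule nf)
  qed
  have "even (card (set P - {x}))" by (rule invol_on_even_card[OF _ inv(1) nfP]) simp
  moreover have "Suc (card (set P - {x})) = card (set P)" by (rule card_Suc_Diff1) (use x in simp_all)
  moreover have "card (set P) = length P" using dist by (simp add: distinct_card)
  ultimately have oddP: "odd (length P)" by (metis even_Suc)
  then have evenQ: "even (length Q)" using odd_n by simp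
  \<comment> \<open>The two alternating matchings of the path from \<open>i\<close> through
    \<open>P\<close> to \<open>j\<close>, which has odd order: \<open>?ei\<close> omits
    \<open>j\<close> and \<open>?ej\<close> omits \<open>i\<close>. Below, those of the path from
    \<open>j\<close> through \<open>Q\<close> to \<open>i\<close>, which has even order.\<close>
  let ?ei = "pairing (i # P)" and ?ej = "pairing (P @ [j])"
  let ?f = "pairing (j # Q @ [i])" and ?w = "pairing Q"
  have E_eq: "?E = arcs (i # P @ [j]) \<union> arcs (j # Q @ [i])"
    using arcs_append[of "i # P" "j # Q @ [i]"] arcs_append[of "i # P" "[j]"] by (auto simp: cyc_def)
  have subs: "arcs (i # P) \<subseteq> ?E" "arcs (P @ [j]) \<subseteq> ?E" "arcs Q \<subseteq> ?E"
  proof -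
    show "arcs (i # P) \<subseteq> ?E" using arcs_append[of "i # P" "[j]"] E_eq by auto
    show "arcs (P @ [j]) \<subseteq> ?E" using arcs_Cons[of "P @ [j]" i] E_eq by auto
    have "arcs Q \<subseteq> arcs (Q @ [i])" by (cases "Q = []") (auto simp: arcs_append)
    also have "\<dots> \<subseteq> arcs (j # Q @ [i])" using arcs_Cons[of "Q @ [i]" j] by auto
    finally show "arcs Q \<subseteq> ?E" using E_eq by auto
  qed
  have dists: "distinct (i # P @ [j])" "distinct (j # Q @ [i])" "distinct (i # P)"
    "distinct (P @ [j])" "distinct Q"
    using dist by auto
  have cov: "u \<in> insert i (set P) \<and> ?ei u = v \<or> u \<in> insert j (set P) \<and> ?ej u = v \<or>
      u \<in> ?W \<and> ?f u = v \<or> u \<in> set Q \<and> ?w u = v" if uv: "(u, v) \<in> ?E" for u v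
  proof -
    from uv E_eq consider "(u, v) \<in> arcs (i # P @ [j])" | "(u, v) \<in> arcs (j # Q @ [i])" by auto
    then show ?thesis
    proof cases
      case 1
      have "u \<noteq> v" "u \<noteq> j" "u \<in> set (i # P @ [j])"
        using arcs_ends[OF dists(1) 1] arcs_sub[OF 1] by auto
      moreover have "pairing ((i # P) @ [j]) = ?ei" using pairing_snoc[of "i # P" j] oddP by simp
      moreover have "pairing (i # P @ [j]) u = v \<or> ?ej u = v" using arcs_pairing[OF dists(1) 1] .
      ultimately show ?thesis using pairing_notin[of u "P @ [j]"] by auto
    next
      case 2
      have "u \<noteq> v" "u \<in> set (j # Q @ [i])"
        using arcs_ends[OF dists(2) 2] arcs_sub[OF 2] by auto
      moreover have "pairing (Q @ [i]) = ?w" using pairing_snoc[of Q i] evenQ by simp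
      moreover have "?f u = v \<or> pairing (Q @ [i]) u = v" using arcs_pairing[OF dists(2) 2] .
      ultimately show ?thesis using pairing_notin[of u Q] by auto
    qed
  qed
  have ei: "invol_on (insert i (set P)) ?ei"
    "\<And>v. v \<in> insert i (set P) \<Longrightarrow> (v, ?ei v) \<in> ?E \<or> (?ei v, v) \<in> ?E"
    using pairing_invol[OF dists(3)] pairing_arcs[OF dists(3)] oddP subs(1) by auto
  have ej: "invol_on (insert j (set P)) ?ej"
    "\<And>v. v \<in> insert j (set P) \<Longrightarrow> (v, ?ej v) \<in> ?E \<or> (?ej v, v) \<in> ?E"
    using pairing_invol[OF dists(4)] pairing_arcs[OF dists(4)] oddP subs(2) by auto
  have setW: "set (j # Q @ [i]) = ?W" by auto
  have f: "invol_on ?W ?f" "\<And>v. v \<in> ?W \<Longrightarrow> (v, ?f v) \<in> ?E \<or> (?f v, v) \<in> ?E"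
    "\<And>v. v \<in> ?W \<Longrightarrow> ?f v \<noteq> v"
    using pairing_invol[OF dists(2)] pairing_arcs[OF dists(2)] pairing_no_fixed[OF dists(2)] evenQ E_eq
    unfolding setW by auto
  have w: "invol_on (set Q) ?w" "\<And>v. v \<in> set Q \<Longrightarrow> (v, ?w v) \<in> ?E \<or> (?w v, v) \<in> ?E"
    using pairing_invol[OF dists(5)] pairing_arcs[OF dists(5)] evenQ subs(3) by auto
  \<comment> \<open>The chords inside \<open>Q\<close>. The vertex \<open>?y\<close> counts as
    unmatched because its chord leads to \<open>P\<close>.\<close>
  define l where "l = (\<lambda>v. if v \<in> {i, j, k, ?y} then v else \<mu> v)"
  have l_inv: "invol_on ?W l"
  proof -
    have "i \<notin> set Q" "j \<notin> set Q" using dist by auto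
    then show ?thesis using inv(2) unfolding l_def invol_on_def by auto
  qed
  have l_eq: "l v = \<mu> v" if "v \<in> ?W - {i, j, k, ?y}" for v using that by (auto simp: l_def)
  obtain Y t where Y: "Y \<subseteq> ?W" "?y \<in> Y" "invol_on Y l" "invol_on Y ?f"
    "{v \<in> Y. l v = v \<or> ?f v = v} \<subseteq> {?y, t}"
    by (rule alternating_component[OF _ l_inv f(1), of ?y]) (use x in \<open>auto simp: l_def\<close>)
  have finY: "finite Y" using Y(1) finite_subset by blast
  \<comment> \<open>Since \<open>?f\<close> has no fixed point, \<open>Y\<close> has even size.
    Hence \<open>?y\<close> cannot be its only vertex fixed by \<open>l\<close>.\<close>
  have "\<exists>s\<in>Y - {?y}. l s = s"
  proof (rule ccontr)
    assume "\<not> ?thesis"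
    then have nfl: "l s \<noteq> s" if "s \<in> Y - {?y}" for s using that by blast
    have "invol_on {?y} l" by (simp add: invol_on_def l_def)
    then have "invol_on (Y - {?y}) l" by (rule invol_on_Diff[OF Y(3)])
    then have "even (card (Y - {?y}))"
      by (rule invol_on_even_card[OF _ _ nfl, rotated]) (use finY in simp_all)
    moreover have "even (card Y)"
      by (rule invol_on_even_card[OF finY Y(4)]) (use Y(1) f(3) in blast)
    moreover have "Suc (card (Y - {?y})) = card Y" using finY Y(2) by (rule card_Suc_Diff1)
    ultimately show False by (metis even_Suc)
  qed
  then have t: "t \<in> Y" "l t = t" "t \<noteq> ?y" using Y(5) by auto
  have ijk: "t \<in> {i, j, k}"
  proof (rule ccontr)
    assume n: "t \<notin> {i, j, k}"
    then have "l t = \<mu> t" "t \<in> set Q - {k}" using l_eq t Y(1) by auto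
    then show False using nf[of t] t(2) by auto
  qed
  have Yt: "Y \<inter> {i, j, k} = {t}"
  proof -
    have "v = t" if "v \<in> Y" "v \<in> {i, j, k}" for v
    proof -
      have "l v = v" using that by (auto simp: l_def)
      then have "v \<in> {?y, t}" using Y(5) that by blast
      then show ?thesis using that k dist x by auto
    qed
    then show ?thesis using t ijk by blast
  qed
  have Y\<mu>: "invol_on (Y - {?y, t}) \<mu>"
  proof -
    have "invol_on {?y, t} l" using t by (auto simp: invol_on_def l_def)
    then have "invol_on (Y - {?y, t}) l" using invol_on_Diff[OF Y(3)] by blast
    moreover have "l v = \<mu> v" if "v \<in> Y - {?y, t}" for v
      using that Yt Y(1) by (auto simp: l_def)
    ultimately show ?thesis by (rule invol_on_cong)
  qed
  have V: "set ?L = insert i (insert j (set P \<union> set Q))" by auto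
  have VX: "insert i (insert j (set P \<union> set Q)) \<inter> X = {i, j, k}" using X by auto
  show ?thesis
  proof (cases "t = i")
    case False
    then obtain t' where "{t, t'} = {j, k}" using ijk by auto
    then show ?thesis unfolding V
      by (intro triple_cover_core[where P = "set P" and Q = "set Q" and ei = ?ei and ej = ?ej and f = ?f
            and w = ?w and x = x and y = ?y and Y = Y and t = t and t' = t'])
        (use dist cov ei ej f w x inv k VX Y Yt Y\<mu> in auto)
  next
    \<comment> \<open>The core lemma does not allow the component to end at \<open>i\<close>, so it
      is applied with \<open>i\<close> and \<open>j\<close> exchanged.\<close>
    case True
    have VX': "insert j (insert i (set P \<union> set Q)) \<inter> X = {j, i, k}" using VX by auto
    have W': "?W = insert j (insert i (set Q))" by auto
    have cov': "u \<in> insert j (set P) \<and> ?ej u = v \<or> u \<in> insert i (set P) \<and> ?ei u = v \<or>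
      u \<in> insert j (insert i (set Q)) \<and> ?f u = v \<or> u \<in> set Q \<and> ?w u = v" if "(u, v) \<in> ?E" for u v
      using cov[OF that] by auto
    have "triple_cover (insert j (insert i (set P \<union> set Q))) ?E X \<mu> {j, i, k}"
      by (intro triple_cover_core[where P = "set P" and Q = "set Q" and ei = ?ej and ej = ?ei and f = ?f
            and w = ?w and x = x and y = ?y and Y = Y and t = i and t' = k])
        (use dist cov' ei ej f[unfolded W'] w x inv k VX' Y(1)[unfolded W'] Y Yt Y\<mu> True in auto)
    then show ?thesis unfolding V by (simp add: insert_commute)
  qed
qed

section \<open>Contracting circuits and lifting triple covers\<close>

text \<open>Applied to the list that follows a fixed vertex \<open>a\<close> of the circuit, so that
  \<open>a\<close> always survives. Single steps may break chords; that the chords are intact is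
  demanded only of the final list.\<close>

inductive contracts :: "'v list \<Rightarrow> 'v list \<Rightarrow> bool" where
  contracts_refl: "contracts xs xs"
| contracts_step: "contracts xs (p @ u # v # q) \<Longrightarrow> contracts xs (p @ q)"

lemma contracts_trans: "contracts ys zs \<Longrightarrow> contracts xs ys \<Longrightarrow> contracts xs zs"
  by (induction rule: contracts.induct) (auto intro: contracts.intros)

lemma contracts_Cons: "contracts xs ys \<Longrightarrow> contracts (x # xs) (x # ys)"
proof (induction rule: contracts.induct)
  case (contracts_step xs p u v q)
  then show ?case using contracts.contracts_step[of "x # xs" "x # p" u v q] by simp
qed (rule contracts_refl)

lemma contracts_properties:
  assumes "contracts xs ys"
  shows "set ys \<subseteq> set xs" "distinct xs \<Longrightarrow> distinct ys" "even (length ys) \<longleftrightarrow> even (length xs)"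
  using assms by (induction rule: contracts.induct) auto

text \<open>Reading from the front, the first entry in \<open>S\<close> can only be matched to its
  successor, so the two form a consecutive pair that can be deleted. The pairs matched by
  \<open>\<tau>\<close> disappear one after the other.\<close>

lemma contracts_filter:
  assumes "distinct ys" "S \<subseteq> set ys" "invol_on S \<tau>"
    "\<And>v. v \<in> S \<Longrightarrow> (v, \<tau> v) \<in> arcs ys \<or> (\<tau> v, v) \<in> arcs ys"
  shows "contracts ys (filter (\<lambda>v. v \<notin> S) ys)"
  using assms
proof (induction "length ys" arbitrary: ys S rule: less_induct)
  case less
  show ?case
  proof (cases ys)
    case Nil
    then show ?thesis by (simp add: contracts_refl)
  next
    case (Cons y zs)
    show ?thesis
    proof (cases "y \<in> S")
      case False
      have "(v, \<tau> v) \<in> arcs zs \<or> (\<tau> v, v) \<in> arcs zs" if "v \<in> S" for v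
        using less.prems(4)[OF that] invol_onD[OF less.prems(3) that] that False Cons
        by (cases zs) auto
      then have "contracts zs (filter (\<lambda>v. v \<notin> S) zs)"
        using less.hyps[of zs S] less.prems Cons False by auto
      then show ?thesis using contracts_Cons False Cons by auto
    next
      case True
      then have "(y, \<tau> y) \<in> arcs (y # zs) \<or> (\<tau> y, y) \<in> arcs (y # zs)"
        using less.prems(4) Cons by simp
      then have "(y, \<tau> y) \<in> arcs (y # zs)" using arcs_ends[of "y # zs"] less.prems(1) Cons by fastforce
      then obtain ws where ws: "zs = \<tau> y # ws"
        using less.prems(1) Cons by (cases zs) (auto dest: arcs_sub)
      let ?S = "S - {y, \<tau> y}"
      have inv: "invol_on ?S \<tau>"
      proof (rule invol_on_Diff[OF less.prems(3)])
        show "invol_on {y, \<tau> y} \<tau>" using invol_onD[OF less.prems(3) True] by (auto simp: invol_on_def)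
      qed
      have "(v, \<tau> v) \<in> arcs ws \<or> (\<tau> v, v) \<in> arcs ws" if v: "v \<in> ?S" for v
      proof -
        have "\<tau> v \<in> ?S" using invol_onD[OF inv v] by simp
        then show ?thesis using less.prems(4)[of v] v Cons ws by (cases ws) auto
      qed
      then have "contracts ws (filter (\<lambda>v. v \<notin> ?S) ws)"
        using less.hyps[of ws ?S] less.prems(1,2) inv Cons ws by auto
      moreover have "filter (\<lambda>v. v \<notin> ?S) ws = filter (\<lambda>v. v \<notin> S) ys"
        using less.prems(1) Cons ws True invol_onD[OF less.prems(3) True] by (auto intro!: filter_cong)
      moreover have "contracts ys ws"
        using contracts_step[OF contracts_refl, of "[]" y "\<tau> y" ws] Cons ws by simp
      ultimately show ?thesis using contracts_trans by metis
    qed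
  qed
qed

text \<open>
  Subdividing the arc \<open>(s, t)\<close> into \<open>s, u, v, t\<close>: matchings that contain \<open>(s, t)\<close> receive \<open>(s, u)\<close> and \<open>(v, t)\<close>,
  the others receive \<open>(u, v)\<close>.
\<close>
lemma triple_cover_append_two:
  assumes dist: "distinct (L @ [u, v])" and len: "length L \<ge> 3"
    and tc: "triple_cover (set L) (cyc L) X \<mu> K"
  shows "triple_cover (set (L @ [u, v])) (cyc (L @ [u, v])) X \<mu> K"
proof -
  \<comment> \<open>A third entry ensures that the predecessor \<open>?s\<close> of \<open>t\<close>
    differs from the successor \<open>x\<close> of \<open>t\<close>.\<close>
  obtain t x y L'' where "L = t # x # y # L''"
    using len by (auto simp: numeral_3_eq_3 Suc_le_length_iff)
  then obtain L' where L: "L = t # x # L'" "L' \<noteq> []" by blast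
  let ?s = "last L"
  have cycL: "cyc L = insert (?s, t) (arcs L)"
    using L arcs_append[of L "[t]"] by (auto simp: cyc_def)
  have cycL2: "cyc (L @ [u, v]) = arcs L \<union> {(?s, u), (u, v), (v, t)}"
    using L arcs_append[of L "[u, v, t]"] by (auto simp: cyc_def)
  have "last L' \<in> set L'" "?s = last L'" using L by auto
  then have s: "?s \<in> set L" "?s \<noteq> t" "?s \<noteq> x" "u \<noteq> v" "u \<notin> set L" "v \<notin> set L" "t \<in> set L"
    using L dist by auto
  have dL: "distinct L" using dist by simp
  have arcs_out: "p \<noteq> ?s \<and> q \<noteq> t \<and> p \<in> set L \<and> q \<in> set L" if "(p, q) \<in> arcs L" for p q
    using arcs_ends[OF dL that] arcs_sub[OF that] L by auto
  have tx: "(t, q) \<in> arcs L \<Longrightarrow> q = x" for q using L dL by (auto dest: arcs_sub)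
  from tc obtain \<nu> where \<nu>: "\<forall>z\<in>K. near_matching (set L) (cyc L) X \<mu> z (\<nu> z)"
    "\<forall>(p, q)\<in>cyc L. \<exists>z\<in>K. \<nu> z p = q"
    unfolding triple_cover_def by (elim exE conjE)
  have near: "near_matching (set L) (cyc L) X \<mu> z (\<nu> z)" if "z \<in> K" for z
    using \<nu>(1) that by simp
  have cov: "\<exists>z\<in>K. \<nu> z p = q" if "(p, q) \<in> cyc L" for p q
    using \<nu>(2) that by fast
  define \<nu>' where "\<nu>' = (\<lambda>z. if \<nu> z ?s = t then (\<nu> z)(?s := u, u := ?s, v := t, t := v)
    else (\<nu> z)(u := v, v := u))"
  have "near_matching (set (L @ [u, v])) (cyc (L @ [u, v])) X \<mu> z (\<nu>' z)" if z: "z \<in> K" for z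
  proof -
    have n: "z \<in> set L" "\<nu> z z = z" "invol_on (set L) (\<nu> z)"
      "\<And>w. w \<in> set L \<Longrightarrow> w \<noteq> z \<Longrightarrow>
        (w, \<nu> z w) \<in> cyc L \<or> (\<nu> z w, w) \<in> cyc L \<or> w \<notin> X \<and> \<nu> z w = \<mu> w"
      using near[OF z] unfolding near_matching_def by auto
    have inL: "\<nu> z w \<in> set L" "\<nu> z (\<nu> z w) = w" if "w \<in> set L" for w
      using invol_onD[OF n(3) that] by auto
    show ?thesis
    proof (cases "\<nu> z ?s = t")
      case True
      then have ts: "\<nu> z t = ?s" using inL[of ?s] s by auto
      then have zst: "z \<noteq> ?s" "z \<noteq> t" using n(2) True s by auto
      have eq: "\<nu>' z = (\<nu> z)(?s := u, u := ?s, v := t, t := v)" using True by (simp add: \<nu>'_def)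
      have other: "\<nu> z w \<noteq> ?s \<and> \<nu> z w \<noteq> t" if "w \<in> set L" "w \<noteq> ?s" "w \<noteq> t" for w
        using inL[OF that(1)] that ts True by metis
      show ?thesis unfolding near_matching_def
      proof (intro conjI ballI)
        show "z \<in> set (L @ [u, v])" "\<nu>' z z = z" using n(1,2) zst s eq by auto
        show "invol_on (set (L @ [u, v])) (\<nu>' z)"
          unfolding invol_on_def
        proof (intro ballI)
          fix w assume "w \<in> set (L @ [u, v])"
          then consider "w = ?s" | "w = t" | "w = u" | "w = v" | "w \<in> set L" "w \<noteq> ?s" "w \<noteq> t" by auto
          then show "\<nu>' z w \<in> set (L @ [u, v]) \<and> \<nu>' z (\<nu>' z w) = w"
          proof cases
            case 5
            then have "w \<noteq> u" "w \<noteq> v" "\<nu> z w \<noteq> u" "\<nu> z w \<noteq> v" using s inL[of w] by auto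
            then show ?thesis using 5 other[of w] inL[of w] unfolding eq by simp
          qed (use s in \<open>auto simp: eq\<close>)
        qed
        fix w assume w: "w \<in> set (L @ [u, v]) - {z}"
        then consider "w = ?s" | "w = t" | "w = u" | "w = v" | "w \<in> set L" "w \<noteq> ?s" "w \<noteq> t" "w \<noteq> z"
          by auto
        then show "(w, \<nu>' z w) \<in> cyc (L @ [u, v]) \<or> (\<nu>' z w, w) \<in> cyc (L @ [u, v]) \<or>
            w \<notin> X \<and> \<nu>' z w = \<mu> w"
        proof cases
          case 5
          then have "w \<noteq> u" "w \<noteq> v" using s by auto
          then have "\<nu>' z w = \<nu> z w" using 5 unfolding eq by simp
          then show ?thesis using n(4)[OF 5(1,4)] 5 other[of w] unfolding cycL cycL2 by auto
        qed (use s in \<open>auto simp: eq cycL2\<close>)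
      qed
    next
      case False
      then have eq: "\<nu>' z = (\<nu> z)(u := v, v := u)" by (simp add: \<nu>'_def)
      have ts: "\<nu> z t \<noteq> ?s" using False inL(2)[of t] s by auto
      have LL: "\<nu>' z w = \<nu> z w" if "w \<in> set L" for w
      proof -
        have "w \<noteq> u" "w \<noteq> v" using that s by auto
        then show ?thesis unfolding eq by simp
      qed
      show ?thesis unfolding near_matching_def
      proof (intro conjI ballI)
        show "z \<in> set (L @ [u, v])" "\<nu>' z z = z" using n(1,2) LL by auto
        show "invol_on (set (L @ [u, v])) (\<nu>' z)"
          unfolding invol_on_def
        proof (intro ballI)
          fix w assume "w \<in> set (L @ [u, v])"
          then consider "w = u" | "w = v" | "w \<in> set L" by auto
          then show "\<nu>' z w \<in> set (L @ [u, v]) \<and> \<nu>' z (\<nu>' z w) = w"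
          proof cases
            case 3
            then show ?thesis using LL inL[of w] by simp
          qed (use s in \<open>auto simp: eq\<close>)
        qed
        fix w assume w: "w \<in> set (L @ [u, v]) - {z}"
        then consider "w = u" | "w = v" | "w \<in> set L" "w \<noteq> z" by auto
        then show "(w, \<nu>' z w) \<in> cyc (L @ [u, v]) \<or> (\<nu>' z w, w) \<in> cyc (L @ [u, v]) \<or>
            w \<notin> X \<and> \<nu>' z w = \<mu> w"
        proof cases
          case 3
          have "(w, \<nu> z w) \<noteq> (?s, t)" "(\<nu> z w, w) \<noteq> (?s, t)" using False ts by auto
          then show ?thesis using n(4)[OF 3] LL[OF 3(1)] unfolding cycL cycL2 by auto
        qed (use s in \<open>auto simp: eq cycL2\<close>)
      qed
    qed
  qed
  moreover have "\<exists>z\<in>K. \<nu>' z p = q" if "(p, q) \<in> cyc (L @ [u, v])" for p q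
  proof -
    obtain z1 where z1: "z1 \<in> K" "\<nu> z1 ?s = t" using cov[of ?s t] cycL by auto
    \<comment> \<open>The matching that contains \<open>(t, x)\<close> cannot contain
      \<open>(?s, t)\<close>, so it is one that receives the new arc \<open>(u, v)\<close>.\<close>
    obtain z2 where z2: "z2 \<in> K" "\<nu> z2 t = x" using cov[of t x] cycL L by auto
    have "\<nu> z2 ?s \<noteq> t"
    proof
      assume "\<nu> z2 ?s = t"
      then have "\<nu> z2 t = ?s" using near[OF z2(1)] s(1) by (metis invol_onD(2) near_matching_def)
      then show False using z2 s by simp
    qed
    then have "\<nu>' z2 u = v" using s by (simp add: \<nu>'_def)
    moreover have "\<nu>' z1 ?s = u" "\<nu>' z1 v = t" using z1 s by (auto simp: \<nu>'_def)
    moreover have "\<exists>z\<in>K. \<nu>' z p = q" if pq: "(p, q) \<in> arcs L"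
    proof -
      obtain z where z: "z \<in> K" "\<nu> z p = q" using cov[of p q] cycL pq by auto
      have "p \<noteq> ?s" "p \<noteq> u" "p \<noteq> v" "q \<noteq> t" using arcs_out[OF pq] s by auto
      moreover have "p \<noteq> t" if h: "\<nu> z ?s = t"
      proof
        assume "p = t"
        then have "q = x" using pq tx by simp
        moreover have "\<nu> z t = ?s" using h near[OF z(1)] s(1) by (metis invol_onD(2) near_matching_def)
        ultimately show False using z \<open>p = t\<close> s by simp
      qed
      ultimately have "\<nu>' z p = q" using z by (auto simp: \<nu>'_def)
      then show ?thesis using z by blast
    qed
    ultimately show ?thesis using \<open>(p, q) \<in> cyc (L @ [u, v])\<close> z1(1) z2(1) unfolding cycL2 by blast
  qed
  ultimately show ?thesis unfolding triple_cover_def by (intro exI[of _ \<nu>']) auto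
qed

text \<open>Contractions are undone one at a time, after rotating the circuit so that the deleted
  pair comes last. Reinserted vertices are matched by circuit edges only, so nothing about their
  chords is needed.\<close>

lemma triple_cover_contracts:
  assumes "contracts zs ys" "distinct (a # zs)" "length ys \<ge> 2"
    and "triple_cover (set (a # ys)) (cyc (a # ys)) X \<mu> K"
  shows "triple_cover (set (a # zs)) (cyc (a # zs)) X \<mu> K"
  using assms
proof (induction rule: contracts.induct)
  case (contracts_step xs p u v q)
  have "distinct (p @ u # v # q)" "a \<notin> set (p @ u # v # q)"
    using contracts_properties(1,2)[OF contracts_step(1)] contracts_step.prems(1) by auto
  then have d: "distinct ((q @ a # p) @ [u, v])" by auto
  have "cyc (a # p @ q) = cyc (q @ a # p)" using cyc_rotate[of "a # p" q] by simp
  moreover have "set (a # p @ q) = set (q @ a # p)" by auto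
  ultimately have "triple_cover (set (q @ a # p)) (cyc (q @ a # p)) X \<mu> K"
    using contracts_step.prems(3) by simp
  then have "triple_cover (set ((q @ a # p) @ [u, v])) (cyc ((q @ a # p) @ [u, v])) X \<mu> K"
    using d contracts_step.prems(2) by (intro triple_cover_append_two) auto
  moreover have "cyc (a # p @ u # v # q) = cyc ((q @ a # p) @ [u, v])"
    using cyc_rotate[of "a # p @ [u, v]" q] by simp
  moreover have "set (a # p @ u # v # q) = set ((q @ a # p) @ [u, v])" by auto
  ultimately have "triple_cover (set (a # p @ u # v # q)) (cyc (a # p @ u # v # q)) X \<mu> K" by simp
  then show ?case using contracts_step.IH contracts_step.prems(1,2) by simp
qed simp

section \<open>Circuits that cannot be contracted further\<close>

lemma arcs_suffix: "arcs q \<subseteq> arcs (p @ q)"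
  by (cases "p = [] \<or> q = []") (auto simp: arcs_append)

lemma arcs_prefix: "arcs p \<subseteq> arcs (p @ q)"
  by (cases "p = [] \<or> q = []") (auto simp: arcs_append)

lemma arcs_infix: "arcs q \<subseteq> arcs (p @ q @ r)"
  using arcs_prefix[of q r] arcs_suffix[of "q @ r" p] by auto

lemma arcs_closed:
  assumes "\<And>u v. (u, v) \<in> arcs p \<Longrightarrow> u \<in> B \<longleftrightarrow> v \<in> B"
  shows "set p \<subseteq> B \<or> set p \<inter> B = {}"
  using assms
proof (induction p rule: arcs.induct)
  case (1 x y zs)
  then have "set (y # zs) \<subseteq> B \<or> set (y # zs) \<inter> B = {}" by auto
  then show ?case using 1(2)[of x y] by auto
qed auto

text \<open>Three parts are distributed over the two nonempty sides \<open>B\<close> and its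
  complement, so one side consists of a single part.\<close>

lemma split_three_parts:
  assumes "S1 \<subseteq> B \<or> S1 \<inter> B = {}" "S2 \<subseteq> B \<or> S2 \<inter> B = {}" "S3 \<subseteq> B \<or> S3 \<inter> B = {}"
    and "B \<subseteq> S1 \<union> S2 \<union> S3" "B \<noteq> {}" "(S1 \<union> S2 \<union> S3) - B \<noteq> {}"
  shows "\<exists>S\<in>{S1, S2, S3}. S = B \<or> S = (S1 \<union> S2 \<union> S3) - B"
proof -
  let ?C = "(S1 \<union> S2 \<union> S3) - B"
  have "S1 = B \<or> S2 = B \<or> S3 = B \<or> S1 = ?C \<or> S2 = ?C \<or> S3 = ?C"
  proof (cases "S1 \<subseteq> B")
    case 1: True
    show ?thesis
    proof (cases "S2 \<subseteq> B")
      case 2: True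
      then have "S3 \<inter> B = {}" using 1 assms(3,6) by blast
      then have "S3 = ?C" using 1 2 by blast
      then show ?thesis by blast
    next
      case False
      then have 2: "S2 \<inter> B = {}" using assms(2) by blast
      show ?thesis
      proof (cases "S3 \<subseteq> B")
        case True
        then have "S2 = ?C" using 1 2 by blast
        then show ?thesis by blast
      next
        case False
        then have "S3 \<inter> B = {}" using assms(3) by blast
        then have "S1 = B" using 1 2 assms(4) by blast
        then show ?thesis by blast
      qed
    qed
  next
    case False
    then have 1: "S1 \<inter> B = {}" using assms(1) by blast
    show ?thesis
    proof (cases "S2 \<subseteq> B")
      case 2: True
      show ?thesis
      proof (cases "S3 \<subseteq> B")
        case True
        then have "S1 = ?C" using 1 2 by blast
        then show ?thesis by blast
      next
        case False
        then have "S3 \<inter> B = {}" using assms(3) by blast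
        then have "S2 = B" using 1 2 assms(4) by blast
        then show ?thesis by blast
      qed
    next
      case False
      then have "S2 \<inter> B = {}" using assms(2) by blast
      then have "S3 = B" using 1 assms(3,4,5) by blast
      then show ?thesis by blast
    qed
  qed
  then show ?thesis by (elim disjE) simp_all
qed

text \<open>Exactly one of the two subpaths has odd length. Leaving out its first vertex
  \<open>z\<close> makes both even, and both can be paired off.\<close>

lemma path_near_pairing:
  assumes "distinct (p @ b # q)" "odd (length p + length q)"
  obtains z \<beta> where "z \<in> set p \<union> set q" "\<beta> z = z" "invol_on (set p \<union> set q) \<beta>"
    "\<And>v. v \<in> set p \<union> set q - {z} \<Longrightarrow> \<beta> v \<noteq> v"
    "\<And>v. v \<in> set p \<union> set q - {z} \<Longrightarrow> (v, \<beta> v) \<in> arcs (p @ b # q) \<or> (\<beta> v, v) \<in> arcs (p @ b # q)"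
proof -
  have "\<exists>z L1 L2. set p \<union> set q = insert z (set L1 \<union> set L2) \<and> even (length L1) \<and> even (length L2) \<and>
      distinct (z # L1 @ L2) \<and> arcs L1 \<union> arcs L2 \<subseteq> arcs (p @ b # q)"
  proof (cases "odd (length p)")
    case True
    then obtain z p' where p: "p = z # p'" by (cases p) auto
    have "arcs p' \<subseteq> arcs (p @ b # q)" using arcs_infix[of p' "[z]" "b # q"] p by simp
    moreover have "arcs q \<subseteq> arcs (p @ b # q)" using arcs_suffix[of q "p @ [b]"] by simp
    ultimately show ?thesis using p True assms
      by (intro exI[of _ z] exI[of _ p'] exI[of _ q]) auto
  next
    case False
    then obtain z q' where q: "q = z # q'" using assms by (cases q) auto
    have "arcs p \<subseteq> arcs (p @ b # q)" using arcs_prefix[of p "b # q"] .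
    moreover have "arcs q' \<subseteq> arcs (p @ b # q)" using arcs_suffix[of q' "p @ [b, z]"] q by simp
    ultimately show ?thesis using q False assms
      by (intro exI[of _ z] exI[of _ p] exI[of _ q']) auto
  qed
  then obtain z L1 L2 where L: "set p \<union> set q = insert z (set L1 \<union> set L2)" "even (length L1)"
    "even (length L2)" "distinct (z # L1 @ L2)" "arcs L1 \<union> arcs L2 \<subseteq> arcs (p @ b # q)"
    by blast
  define \<beta> where "\<beta> = (\<lambda>v. if v \<in> set L1 then pairing L1 v else pairing L2 v)"
  have d: "distinct L1" "distinct L2" "set L1 \<inter> set L2 = {}" "z \<notin> set L1" "z \<notin> set L2" using L(4) by auto
  have z: "\<beta> z = z" using d by (simp add: \<beta>_def pairing_notin)
  have b1: "\<beta> v = pairing L1 v" "\<beta> v \<in> set L1" "\<beta> (\<beta> v) = v" if "v \<in> set L1" for v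
    using invol_onD[OF pairing_invol[OF d(1)] that] that by (simp_all add: \<beta>_def)
  have b2: "\<beta> v = pairing L2 v" "\<beta> v \<in> set L2" "\<beta> (\<beta> v) = v" if "v \<in> set L2" for v
  proof -
    have "pairing L2 v \<in> set L2" "pairing L2 (pairing L2 v) = v"
      using invol_onD[OF pairing_invol[OF d(2)] that] by auto
    moreover from this have "v \<notin> set L1" "pairing L2 v \<notin> set L1" using that d(3) by auto
    ultimately show "\<beta> v = pairing L2 v" "\<beta> v \<in> set L2" "\<beta> (\<beta> v) = v" by (simp_all add: \<beta>_def)
  qed
  show thesis
  proof (rule that[of z \<beta>])
    show "invol_on (set p \<union> set q) \<beta>"
      unfolding L(1) invol_on_def
    proof (intro ballI)
      fix v assume "v \<in> insert z (set L1 \<union> set L2)"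
      then consider "v = z" | "v \<in> set L1" | "v \<in> set L2" by blast
      then show "\<beta> v \<in> insert z (set L1 \<union> set L2) \<and> \<beta> (\<beta> v) = v"
        by cases (use z b1 b2 in auto)
    qed
    fix v assume "v \<in> set p \<union> set q - {z}"
    then consider "v \<in> set L1" | "v \<in> set L2" using L(1) by blast
    then show "\<beta> v \<noteq> v"
      by cases (use b1(1) b2(1) pairing_no_fixed[OF d(1) L(2)] pairing_no_fixed[OF d(2) L(3)] in auto)
  next
    fix v assume "v \<in> set p \<union> set q - {z}"
    then consider "v \<in> set L1" | "v \<in> set L2" using L(1) by blast
    then show "(v, \<beta> v) \<in> arcs (p @ b # q) \<or> (\<beta> v, v) \<in> arcs (p @ b # q)"
    proof cases
      case 1
      then show ?thesis using pairing_arcs[OF d(1) L(2) 1] b1(1)[OF 1] L(5) by auto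
    next
      case 2
      then show ?thesis using pairing_arcs[OF d(2) L(3) 2] b2(1)[OF 2] L(5) by auto
    qed
  qed (use L z in auto)
qed

text \<open>The last assumption expresses minimality: a set \<open>S\<close> matched by circuit
  edges could be deleted by \<open>contracts_filter\<close>, and the closure of \<open>S - X\<close>
  under \<open>\<mu>\<close> would keep the remaining chords intact. \<open>S\<close> may contain
  crossing vertices other than \<open>a\<close> and \<open>b\<close>.\<close>

locale reduced_circle =
  fixes a b :: 'v and ys :: "'v list" and X :: "'v set" and \<mu> :: "'v \<Rightarrow> 'v"
  assumes dist: "distinct (a # ys)" and even_len: "even (length ys)"
    and a: "a \<in> X" and b: "b \<in> X" "b \<in> set ys"
    and inv: "invol_on (set ys - X) \<mu>"
    and nf: "\<And>v. v \<in> set ys - X \<Longrightarrow> \<mu> v \<noteq> v"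
    and minimal: "\<And>S \<tau>. S \<subseteq> set ys - {b} \<Longrightarrow> S \<noteq> {} \<Longrightarrow> invol_on (S - X) \<mu> \<Longrightarrow> invol_on S \<tau> \<Longrightarrow>
      \<exists>v\<in>S. (v, \<tau> v) \<notin> arcs ys \<and> (\<tau> v, v) \<notin> arcs ys"
begin

text \<open>
  The paths left by deleting \<open>a\<close> and \<open>b\<close> from the circuit have a near-perfect matching \<open>\<beta>\<close>. In its union
  with the chords, the component of the unmatched vertex has at most two crossing vertices; by
  minimality there is nothing outside it, and by parity exactly one crossing vertex remains.
\<close>
lemma third_cross:
  obtains c where "c \<noteq> a" "c \<noteq> b" "set (a # ys) \<inter> X = {a, b, c}" "c \<in> set ys"
proof -
  obtain p q where ys: "ys = p @ b # q" using b(2) split_list by metis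
  let ?W = "set p \<union> set q"
  have W: "?W = set ys - {b}" using ys dist by auto
  obtain z \<beta> where \<beta>: "z \<in> ?W" "\<beta> z = z" "invol_on ?W \<beta>"
    "\<And>v. v \<in> ?W - {z} \<Longrightarrow> \<beta> v \<noteq> v"
    "\<And>v. v \<in> ?W - {z} \<Longrightarrow> (v, \<beta> v) \<in> arcs ys \<or> (\<beta> v, v) \<in> arcs ys"
    using path_near_pairing[of p b q] dist even_len ys by auto
  \<comment> \<open>Crossing vertices become fixed points of \<open>\<alpha>\<close>, so a component
    of \<open>\<alpha>\<close> and \<open>\<beta>\<close> contains few of them.\<close>
  define \<alpha> where "\<alpha> = (\<lambda>v. if v \<in> X then v else \<mu> v)"
  have WX: "?W - X = set ys - X" using W b by auto
  have \<alpha>: "invol_on ?W \<alpha>"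
  proof -
    have "invol_on (?W - X) \<alpha>" using inv unfolding WX
      by (rule invol_on_cong) (auto simp: \<alpha>_def)
    moreover have "invol_on (?W \<inter> X) \<alpha>" by (auto simp: invol_on_def \<alpha>_def)
    moreover have "?W = (?W - X) \<union> (?W \<inter> X)" by blast
    ultimately show ?thesis using invol_on_Un by metis
  qed
  obtain Y t where Y: "Y \<subseteq> ?W" "z \<in> Y" "invol_on Y \<beta>" "invol_on Y \<alpha>"
    "{v \<in> Y. \<beta> v = v \<or> \<alpha> v = v} \<subseteq> {z, t}"
    by (rule alternating_component[OF _ \<beta>(3) \<alpha> \<beta>(1,2)]) auto
  have "?W - Y = {}"
  proof (rule ccontr)
    assume ne: "?W - Y \<noteq> {}"
    have "invol_on (?W - Y - X) \<alpha>"
    proof -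
      have "invol_on ((?W - Y) \<inter> X) \<alpha>" by (auto simp: invol_on_def \<alpha>_def)
      then have "invol_on ((?W - Y) - ((?W - Y) \<inter> X)) \<alpha>"
        using invol_on_Diff[OF \<alpha> Y(4)] invol_on_Diff by blast
      moreover have "(?W - Y) - ((?W - Y) \<inter> X) = ?W - Y - X" by blast
      ultimately show ?thesis by simp
    qed
    then have "invol_on (?W - Y - X) \<mu>" by (rule invol_on_cong) (auto simp: \<alpha>_def)
    moreover have "?W - Y \<subseteq> set ys - {b}" using W by auto
    ultimately obtain v where "v \<in> ?W - Y" "(v, \<beta> v) \<notin> arcs ys \<and> (\<beta> v, v) \<notin> arcs ys"
      using minimal[OF _ ne _ invol_on_Diff[OF \<beta>(3) Y(3)]] by blast
    then show False using \<beta>(5)[of v] Y(2) by blast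
  qed
  then have "?W \<inter> X \<subseteq> {z, t}" using Y(1,5) by (auto simp: \<alpha>_def)
  moreover have "odd (card (?W \<inter> X))"
  proof -
    have inv': "invol_on (?W - X) \<mu>" using inv WX by simp
    have "even (card (?W - X))"
      by (rule invol_on_even_card[OF _ inv']) (use nf WX in auto)
    moreover have "card ?W = card (?W \<inter> X) + card (?W - X)"
      by (metis List.finite_set card_Int_Diff finite_Un)
    moreover have "card ?W = length p + length q"
      using dist ys by (simp add: card_Un_disjoint distinct_card)
    ultimately show ?thesis using even_len ys by simp
  qed
  moreover have "card {z, t} \<le> 2" by (cases "z = t") auto
  ultimately have "card (?W \<inter> X) \<le> 2" "odd (card (?W \<inter> X))"
    using card_mono[of "{z, t}" "?W \<inter> X"] by auto
  then have "card (?W \<inter> X) = 1" by presburger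
  then obtain c where "?W \<inter> X = {c}" using card_1_singletonE by blast
  then show thesis using that[of c] W a b dist by auto
qed

text \<open>Deleting the three crossing vertices leaves three possibly empty paths, each inside or
  outside the set \<open>B\<close> of \<open>matching_bridge\<close>. One side is thus a single
  path, which is left by one chord only, and \<open>triple_cover_single_chord\<close>
  applies.\<close>

theorem triple_cover_reduced:
  obtains c where "c \<in> X \<inter> set ys" "c \<noteq> b" "triple_cover (set (a # ys)) (cyc (a # ys)) X \<mu> {a, b, c}"
    "length ys \<ge> 2"
proof -
  obtain c where c: "c \<noteq> a" "c \<noteq> b" "set (a # ys) \<inter> X = {a, b, c}" "c \<in> set ys"
    by (rule third_cross)
  have len: "length ys \<ge> 2"
    using c b by (cases ys; cases "tl ys") auto
  let ?V = "set ys - {b, c}"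
  have "set ys \<inter> X \<subseteq> {a, b, c}" "a \<notin> set ys" using c(3) dist by auto
  then have VX: "?V = set ys - X" using c(3) b by auto
  have "triple_cover (set (a # ys)) (cyc (a # ys)) X \<mu> {a, b, c}"
  proof (cases "?V = {}")
    case True
    then have sy: "set ys = {b, c}" using b c by auto
    then have "length ys = 2" using distinct_card[of ys] dist c by simp
    then obtain u v where uv: "ys = [u, v]" by (auto simp: length_Suc_conv numeral_2_eq_2)
    have "a \<notin> set ys" "distinct ys" using dist by simp_all
    then have ys: "ys = [u, v]" "{u, v} = {b, c}" "u \<noteq> v" "a \<noteq> u" "a \<noteq> v"
      using sy unfolding uv by auto
    \<comment> \<open>Without chords the circuit is a triangle; the matching that misses
      \<open>z\<close> joins the other two vertices.\<close>
    have "triple_cover {a, u, v} (cyc [a, u, v]) X \<mu> {a, u, v}"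
      unfolding triple_cover_def near_matching_def invol_on_def cyc_def
      by (rule exI[of _ "\<lambda>z w. if w = z then z else if w = a then (if z = u then v else u)
          else if w = u then (if z = a then v else a) else (if z = a then u else a)"])
        (use ys(3-5) in auto)
    moreover have "{a, u, v} = {a, b, c}" using ys by auto
    ultimately show ?thesis using ys(1) by simp
  next
    case False
    \<comment> \<open>The edges besides the chords are the circuit edges between non-crossing
      vertices; minimality then says that the chords form the only perfect matching.\<close>
    define A where "A = (\<lambda>u v. u \<in> ?V \<and> v \<in> ?V \<and> ((u, v) \<in> arcs ys \<or> (v, u) \<in> arcs ys))"
    interpret uniquely_matched_graph ?V \<mu> A
    proof
      show "invol_on ?V \<mu>" using inv VX by simp
      show "\<mu> v \<noteq> v" if "v \<in> ?V" for v using nf VX that by simp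
      show "\<not> A v v" for v using arcs_ends[of ys v v] dist by (auto simp: A_def)
      show "\<exists>v\<in>S. \<not> A v (\<tau> v)" if S: "S \<subseteq> ?V" "S \<noteq> {}" "invol_on S \<mu>" "invol_on S \<tau>" for S \<tau>
      proof -
        have "S - X = S" using S(1) VX by blast
        then obtain v where "v \<in> S" "(v, \<tau> v) \<notin> arcs ys \<and> (\<tau> v, v) \<notin> arcs ys"
          using minimal[of S \<tau>] S by auto
        then show ?thesis by (auto simp: A_def)
      qed
    qed (auto simp: A_def)
    obtain B r where B: "B \<subseteq> ?V" "r \<in> B" "\<mu> r \<in> ?V - B" "invol_on (B - {r}) \<mu>"
      "\<And>v w. v \<in> B \<Longrightarrow> w \<in> ?V \<Longrightarrow> A v w \<Longrightarrow> w \<in> B"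
      using matching_bridge False by blast
    have \<mu>\<mu>: "\<mu> (\<mu> r) = r" "\<mu> r \<noteq> r" using B(1,2) invol no_fixed by (auto simp: invol_on_def)
    \<comment> \<open>\<open>B\<close> and its complement play symmetric roles, with
      \<open>r\<close> and \<open>\<mu> r\<close> as ends of the bridge; either may turn out to be
      the single path.\<close>
    let ?B' = "?V - B"
    have B': "invol_on (?B' - {\<mu> r}) \<mu>"
    proof -
      have "invol_on {r, \<mu> r} \<mu>" using \<mu>\<mu> by (simp add: invol_on_def)
      then have "invol_on (B - {r} \<union> {r, \<mu> r}) \<mu>" using B(4) invol_on_Un by blast
      then have "invol_on (?V - (B - {r} \<union> {r, \<mu> r})) \<mu>" using invol invol_on_Diff by blast
      moreover have "?V - (B - {r} \<union> {r, \<mu> r}) = ?B' - {\<mu> r}" using B(2) by blast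
      ultimately show ?thesis by simp
    qed
    \<comment> \<open>The vertices \<open>b\<close> and \<open>c\<close> may occur in either order
      along \<open>ys\<close>.\<close>
    obtain d1 d2 p1 p2 p3 where ys: "ys = p1 @ d1 # p2 @ d2 # p3" "{d1, d2} = {b, c}"
    proof -
      obtain p q where pq: "ys = p @ b # q" using b(2) split_list by metis
      show thesis
      proof (cases "c \<in> set p")
        case True
        then obtain p' p'' where "p = p' @ c # p''" using split_list by metis
        then show thesis using that[of p' c p'' b q] pq by (simp add: insert_commute)
      next
        case False
        then have "c \<in> set q" using pq c by auto
        then obtain q' q'' where "q = q' @ c # q''" using split_list by metis
        then show thesis using that[of p b q' c q''] pq by simp
      qed
    qed
    have Veq: "?V = set p1 \<union> set p2 \<union> set p3" using ys dist by (auto simp: doubleton_eq_iff)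
    have sub: "arcs p1 \<subseteq> arcs ys" "arcs p2 \<subseteq> arcs ys" "arcs p3 \<subseteq> arcs ys"
      using arcs_prefix[of p1 "d1 # p2 @ d2 # p3"] arcs_infix[of p2 "p1 @ [d1]" "d2 # p3"]
        arcs_suffix[of p3 "p1 @ d1 # p2 @ [d2]"] ys(1) by auto
    have closed: "set p \<subseteq> B \<or> set p \<inter> B = {}" if "arcs p \<subseteq> arcs ys" "set p \<subseteq> ?V" for p
    proof (rule arcs_closed)
      fix u v assume uv: "(u, v) \<in> arcs p"
      then have "A u v" "A v u" using that arcs_sub[OF uv] by (auto simp: A_def)
      then show "u \<in> B \<longleftrightarrow> v \<in> B" using B(5)[of u v] B(5)[of v u] by (auto simp: A_def)
    qed
    have cl: "set p1 \<subseteq> B \<or> set p1 \<inter> B = {}" "set p2 \<subseteq> B \<or> set p2 \<inter> B = {}"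
      "set p3 \<subseteq> B \<or> set p3 \<inter> B = {}"
      using closed[OF sub(1)] closed[OF sub(2)] closed[OF sub(3)] Veq by blast+
    obtain x p where x: "p \<in> {p1, p2, p3}" "x \<in> set p" "\<mu> x \<in> ?V - set p" "\<mu> (\<mu> x) = x"
      "invol_on (set p - {x}) \<mu>" "invol_on (?V - set p - {\<mu> x}) \<mu>"
    proof -
      have "\<exists>p\<in>{p1, p2, p3}. set p = B \<or> set p = ?B'"
      proof -
        have "B \<noteq> {}" "?B' \<noteq> {}" using B(2,3) by blast+
        then have "\<exists>S\<in>{set p1, set p2, set p3}. S = B \<or> S = (set p1 \<union> set p2 \<union> set p3) - B"
          using cl B(1) unfolding Veq by (intro split_three_parts) auto
        then show ?thesis unfolding Veq by auto
      qed
      then obtain p where p: "p \<in> {p1, p2, p3}" "set p = B \<or> set p = ?B'" by blast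
      from p(2) show thesis
      proof
        assume "set p = B"
        then show thesis using that[of p r] p(1) B B' \<mu>\<mu> by simp
      next
        assume eq: "set p = ?B'"
        then have "?V - set p = B" using B(1) by blast
        then show thesis using that[of p "\<mu> r"] p(1) B B' \<mu>\<mu> eq by simp
      qed
    qed
    \<comment> \<open>Any rotation of the circuit that puts the single path \<open>p\<close> in the
      place of \<open>P\<close> will do; the three choices of \<open>p\<close> follow below.\<close>
    have main: "triple_cover (set (a # ys)) (cyc (a # ys)) X \<mu> {a, b, c}"
      if rot: "cyc (i # P @ j # Q) = cyc (a # ys)" "set (i # P @ j # Q) = set (a # ys)"
        "length (i # P @ j # Q) = length (a # ys)" "{i, j, k} = {a, b, c}" "k \<in> set Q" "P = p"
      for i P j Q k
    proof -
      have d: "distinct (i # P @ j # Q)" using rot(2,3) dist card_distinct distinct_card by metis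
      have "k \<noteq> i" "k \<noteq> j" "i \<noteq> j" using d rot(5) by auto
      have setQ: "set Q - {k} = ?V - set P"
      proof -
        have "insert i (insert j (set P \<union> set Q)) = insert a (set ys)" using rot(2) by auto
        moreover have "?V = insert a (set ys) - {i, j, k}" unfolding rot(4) using dist c b by auto
        ultimately have "?V = insert i (insert j (set P \<union> set Q)) - {i, j, k}" by simp
        moreover have "k \<notin> set P" "i \<notin> set Q" "j \<notin> set Q" "i \<notin> set P" "j \<notin> set P" "set P \<inter> set Q = {}"
          using d rot(5) by auto
        ultimately show ?thesis by blast
      qed
      have "set Q - {k, \<mu> x} = ?V - set P - {\<mu> x}" using setQ by blast
      then have "triple_cover (set (i # P @ j # Q)) (cyc (i # P @ j # Q)) X \<mu> {i, j, k}"
      proof (intro triple_cover_single_chord[OF d, of X k \<mu> x], goal_cases)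
        case 1
        then show ?case using rot(3) even_len by simp
      next
        case 2
        then show ?case using rot(2,4) c(3) by (simp only:) blast
      next
        case (10 v)
        have "set P \<subseteq> ?V" using x(1) rot(6) Veq by auto
        then have "v \<in> ?V" using 10 setQ by auto
        then show ?case using no_fixed by blast
      qed (use rot x setQ in auto)
      then show ?thesis using rot by simp
    qed
    consider "p = p1" | "p = p2" | "p = p3" using x(1) by blast
    then show ?thesis
    proof cases
      case 1
      show ?thesis
        by (rule main[of a p1 d1 "p2 @ d2 # p3" d2]) (use 1 ys in auto)
    next
      case 2
      have "cyc (d1 # p2 @ d2 # p3 @ a # p1) = cyc (a # ys)"
        using cyc_rotate[of "a # p1" "d1 # p2 @ d2 # p3"] ys by simp
      then show ?thesis
        by (intro main[of d1 p2 d2 "p3 @ a # p1" a]) (use 2 ys in auto)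
    next
      case 3
      have "cyc (d2 # p3 @ a # p1 @ d1 # p2) = cyc (a # ys)"
        using cyc_rotate[of "a # p1 @ d1 # p2" "d2 # p3"] ys by simp
      then show ?thesis
        by (intro main[of d2 p3 a "p1 @ d1 # p2" d1]) (use 3 ys in auto)
    qed
  qed
  then show thesis using that c(2,3,4) len by blast
qed

end

text \<open>A shortest contraction that keeps \<open>b\<close> and leaves the chords intact
  satisfies \<open>reduced_circle\<close>. Its triple cover lifts back to the given circuit.\<close>

theorem circle_triple_cover:
  assumes dist: "distinct (a # zs)" and odd_len: "odd (length (a # zs))"
    and ab: "a \<in> X" "b \<in> X" "b \<in> set zs"
    and inv: "invol_on (set (a # zs) - X) \<mu>" and nf: "\<And>v. v \<in> set (a # zs) - X \<Longrightarrow> \<mu> v \<noteq> v"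
  obtains c where "c \<in> X \<inter> set zs" "c \<noteq> b"
    "triple_cover (set (a # zs)) (cyc (a # zs)) X \<mu> {a, b, c}"
proof -
  let ?P = "\<lambda>ys. contracts zs ys \<and> b \<in> set ys \<and> invol_on (set ys - X) \<mu>"
  have "set (a # zs) - X = set zs - X" using ab(1) by auto
  then have "?P zs" using ab(3) inv contracts_refl by auto
  then obtain ys where ys: "?P ys" "\<And>us. ?P us \<Longrightarrow> length ys \<le> length us"
    using ex_has_least_nat[of ?P zs length] by blast
  have sub: "set ys \<subseteq> set zs" "distinct ys" "even (length ys) \<longleftrightarrow> even (length zs)"
    using contracts_properties[of zs ys] ys(1) dist by auto
  interpret reduced_circle a b ys X \<mu>
  proof
    show "distinct (a # ys)" using sub dist by auto
    show "even (length ys)" using sub odd_len by simp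
    show "\<mu> v \<noteq> v" if "v \<in> set ys - X" for v using nf[of v] that sub by auto
    show "\<exists>v\<in>S. (v, \<tau> v) \<notin> arcs ys \<and> (\<tau> v, v) \<notin> arcs ys"
      if S: "S \<subseteq> set ys - {b}" "S \<noteq> {}" "invol_on (S - X) \<mu>" "invol_on S \<tau>" for S \<tau>
    proof (rule ccontr)
      assume "\<not> ?thesis"
      then have "contracts ys (filter (\<lambda>v. v \<notin> S) ys)"
        using S sub(2) by (intro contracts_filter) auto
      then have "contracts zs (filter (\<lambda>v. v \<notin> S) ys)" using contracts_trans ys(1) by blast
      moreover have "b \<in> set (filter (\<lambda>v. v \<notin> S) ys)" using S(1) ys(1) by auto
      moreover have "invol_on (set (filter (\<lambda>v. v \<notin> S) ys) - X) \<mu>"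
      proof -
        have "set (filter (\<lambda>v. v \<notin> S) ys) - X = (set ys - X) - (S - X)" by auto
        then show ?thesis using invol_on_Diff ys(1) S(3) by metis
      qed
      ultimately have "length ys \<le> length (filter (\<lambda>v. v \<notin> S) ys)" using ys(2) by blast
      moreover have "length (filter (\<lambda>v. v \<notin> S) ys) < length ys"
      proof -
        obtain s where "s \<in> S" using S(2) by blast
        then show ?thesis using S(1) by (intro length_filter_less[where x = s]) auto
      qed
      ultimately show False by simp
    qed
  qed (use ys(1) ab in auto)
  obtain c where c: "c \<in> X \<inter> set ys" "c \<noteq> b"
    "triple_cover (set (a # ys)) (cyc (a # ys)) X \<mu> {a, b, c}" "length ys \<ge> 2"
    by (rule triple_cover_reduced)
  have "contracts zs ys" using ys(1) by blast
  then have "triple_cover (set (a # zs)) (cyc (a # zs)) X \<mu> {a, b, c}"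
    by (rule triple_cover_contracts[OF _ assms(1) c(4,3)])
  moreover have "c \<in> X \<inter> set zs" using c(1) sub(1) by blast
  ultimately show thesis using that c(2) by blast
qed

section \<open>Cubic graphs with a 2-factor\<close>

lemma perfect_matchingI:
  assumes "loopless_graph G" "M \<subseteq> edges G"
    and "\<And>v. v \<in> verts G \<Longrightarrow> \<exists>e. {e' \<in> M. v \<in> ends G e'} = {e}"
  shows "perfect_matching G M"
proof -
  let ?F = "G\<lparr>edges := M\<rparr>"
  have "loopless_graph ?F"
    using assms(1,2) finite_subset unfolding loopless_graph_def by auto
  moreover have "degree ?F v = 1" if "v \<in> verts G" for v
    using assms(3)[OF that] unfolding degree_def by auto
  ultimately have "factor 1 ?F G"
    using assms(2) unfolding factor_def spanning_subgraph_def subgraph_def regular_def by auto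
  then show ?thesis unfolding perfect_matching_def by (intro exI[of _ ?F]) simp
qed

text \<open>An odd circuit minus a vertex is a path of even order. This completes a prescribed near
  matching of the other circuit when no particular edges need to be covered here.\<close>

lemma near_matching_pairing:
  assumes "distinct xs" "odd (length xs)" "x \<in> set xs"
  obtains \<nu> where "near_matching (set xs) (cyc xs) X \<mu> x \<nu>"
proof -
  obtain p q where xs: "xs = p @ x # q" using assms(3) split_list by metis
  let ?L = "q @ p"
  have L: "distinct ?L" "even (length ?L)" "x \<notin> set ?L" "set xs = insert x (set ?L)"
    using assms xs by auto
  have cyc: "arcs ?L \<subseteq> cyc xs"
  proof -
    have "cyc xs = arcs (x # ?L @ [x])" using cyc_rotate[of p "x # q"] xs by (simp add: cyc_def)
    then show ?thesis using arcs_infix[of ?L "[x]" "[x]"] by simp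
  qed
  have "near_matching (set xs) (cyc xs) X \<mu> x (pairing ?L)"
    unfolding near_matching_def L(4)
  proof (intro conjI ballI)
    show "pairing ?L x = x" using L(3) by (rule pairing_notin)
    then show "invol_on (insert x (set ?L)) (pairing ?L)"
      using pairing_invol[OF L(1)] by (auto simp: invol_on_def)
    fix v assume "v \<in> insert x (set ?L) - {x}"
    then show "(v, pairing ?L v) \<in> cyc xs \<or> (pairing ?L v, v) \<in> cyc xs \<or> v \<notin> X \<and> pairing ?L v = \<mu> v"
      using pairing_arcs[OF L(1,2), of v] cyc by auto
  qed simp
  then show thesis by (rule that)
qed

corollary circle_triple_cover':
  assumes "distinct xs" "odd (length xs)" "a \<in> X \<inter> set xs" "b \<in> X \<inter> set xs" "a \<noteq> b"
    and "invol_on (set xs - X) \<mu>" "\<And>v. v \<in> set xs - X \<Longrightarrow> \<mu> v \<noteq> v"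
  obtains c where "c \<in> X \<inter> set xs" "triple_cover (set xs) (cyc xs) X \<mu> {a, b, c}"
proof -
  obtain p q where xs: "xs = p @ a # q" using assms(3) split_list by (metis IntD2)
  have eq: "set (a # q @ p) = set xs" "cyc (a # q @ p) = cyc xs"
    using xs cyc_rotate[of p "a # q"] by auto
  obtain c where c: "c \<in> X \<inter> set (q @ p)" "triple_cover (set (a # q @ p)) (cyc (a # q @ p)) X \<mu> {a, b, c}"
  proof (rule circle_triple_cover[of a "q @ p" X b \<mu>])
    show "distinct (a # q @ p)" "odd (length (a # q @ p))" "b \<in> set (q @ p)"
      using assms xs by auto
    show "invol_on (set (a # q @ p) - X) \<mu>" using assms(6) eq by simp
    show "\<mu> v \<noteq> v" if "v \<in> set (a # q @ p) - X" for v using assms(7)[of v] that unfolding eq by blast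
  qed (use assms in auto)
  then show thesis using that[of c] eq xs by auto
qed

text \<open>After rotation \<open>v\<close> heads a list of at least three entries, and
  \<open>f v\<close> and \<open>f (f v)\<close> are the next two. This rules out circuits of length
  two, where a pair of vertices is joined by two circuit edges.\<close>

lemma successor_not_involutive:
  assumes dist: "distinct xs" and odd: "odd (length xs)" and v: "v \<in> set xs"
    and cyc: "cyc xs = (\<lambda>v. (v, f v)) ` set xs" and no_fix: "f v \<noteq> v"
  shows "f (f v) \<noteq> v"
proof
  assume inv: "f (f v) = v"
  obtain p q where xs: "xs = p @ v # q" using v split_list by metis
  define r where "r = q @ p"
  have r: "distinct (v # r)" "even (length r)" using dist odd xs by (auto simp: r_def)
  have arcs: "arcs (v # r @ [v]) = (\<lambda>v. (v, f v)) ` set xs"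
    using cyc cyc_rotate[of p "v # q"] xs by (simp add: cyc_def r_def)
  have vf: "(v, f v) \<in> arcs (v # r @ [v])" unfolding arcs using v by blast
  then have "r \<noteq> []" using no_fix by auto
  then obtain w ws where w: "r = w # ws" by (cases r) auto
  have "(v, w) \<in> arcs (v # r @ [v])" using w by simp
  then have fv: "f v = w" unfolding arcs by auto
  have "ws \<noteq> []" using r(2) w by auto
  then obtain y ys where y: "ws = y # ys" by (cases ws) auto
  have "(w, y) \<in> arcs (v # r @ [v])" using w y by simp
  then have "f w = y" unfolding arcs by auto
  then show False using inv fv r(1) w y by auto
qed

text \<open>
  The edges \<open>ce v\<close> form the 2-factor, \<open>nx\<close> being the successor on its circuits; the remaining
  edges \<open>me v\<close> form a perfect matching with mate function \<open>\<mu>\<close>.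
\<close>
locale circuit_graph =
  fixes G :: "('v, 'e) multigraph" and ce me :: "'v \<Rightarrow> 'e" and nx \<mu> :: "'v \<Rightarrow> 'v"
  assumes loopless: "loopless_graph G"
    and ce: "v \<in> verts G \<Longrightarrow> ce v \<in> edges G \<and> ends G (ce v) = {v, nx v}"
    and nx: "bij_betw nx (verts G) (verts G)"
    and ce_inj: "inj_on ce (verts G)"
    and me: "v \<in> verts G \<Longrightarrow> me v \<in> edges G \<and> ends G (me v) = {v, \<mu> v}"
    and \<mu>: "invol_on (verts G) \<mu>" "v \<in> verts G \<Longrightarrow> \<mu> v \<noteq> v"
    and me_\<mu>: "v \<in> verts G \<Longrightarrow> me (\<mu> v) = me v"
    and edges_G: "edges G = ce ` verts G \<union> me ` verts G"
begin

lemma nx_inj: "u \<in> verts G \<Longrightarrow> v \<in> verts G \<Longrightarrow> nx u = nx v \<Longrightarrow> u = v"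
  using nx by (auto simp: bij_betw_def inj_on_def)

lemma perfect_matching_me: "perfect_matching G (me ` verts G)"
proof (rule perfect_matchingI[OF loopless])
  fix v assume v: "v \<in> verts G"
  have "e = me v" if "e \<in> me ` verts G" "v \<in> ends G e" for e
    using that me me_\<mu> by auto
  then have "{e \<in> me ` verts G. v \<in> ends G e} = {me v}" using v me[OF v] by auto
  then show "\<exists>e. {e \<in> me ` verts G. v \<in> ends G e} = {e}" by blast
qed (use edges_G in auto)

text \<open>The edge \<open>ce v\<close> inherits the colour of \<open>v\<close>. The two circuit
  edges at a vertex belong to that vertex and to its predecessor, whose colours differ.\<close>

lemma perfect_matching_alternating:
  assumes col: "\<And>v. v \<in> verts G \<Longrightarrow> col (nx v) \<noteq> col v"
  shows "perfect_matching G (ce ` {v \<in> verts G. col v = (t :: bool)})"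
proof (rule perfect_matchingI[OF loopless])
  fix v assume v: "v \<in> verts G"
  obtain u where u: "u \<in> verts G" "nx u = v" using nx v by (metis bij_betw_imp_surj_on imageE)
  let ?N = "ce ` {v \<in> verts G. col v = t}"
  have "{e \<in> ?N. v \<in> ends G e} = {if col v = t then ce v else ce u}"
  proof (intro equalityI subsetI)
    fix e assume "e \<in> {e \<in> ?N. v \<in> ends G e}"
    then obtain w where w: "w \<in> verts G" "col w = t" "e = ce w" "v = w \<or> v = nx w"
      using ce by auto
    show "e \<in> {if col v = t then ce v else ce u}"
    proof (cases "v = w")
      case False
      then have "w = u" using nx_inj[OF w(1) u(1)] u(2) w(4) by simp
      then show ?thesis using col[OF u(1)] u(2) w(2,3) by auto
    qed (use w in simp)
  next
    fix e assume "e \<in> {if col v = t then ce v else ce u}"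
    then show "e \<in> {e \<in> ?N. v \<in> ends G e}"
      using v u ce[OF v] ce[OF u(1)] col[OF u(1)] by (auto split: if_splits)
  qed
  then show "\<exists>e. {e \<in> ?N. v \<in> ends G e} = {e}" by blast
qed (use edges_G in auto)

text \<open>A pair of consecutive vertices yields the \<open>ce\<close> edge of the one that
  precedes the other. An \<open>me\<close> edge is taken only for the remaining pairs, so a chord
  parallel to a circuit edge is not selected in addition to it.\<close>

lemma perfect_matching_involution:
  assumes no2: "\<And>v. v \<in> verts G \<Longrightarrow> nx (nx v) \<noteq> v"
    and \<nu>: "invol_on (verts G) \<nu>"
    and adj: "\<And>v. v \<in> verts G \<Longrightarrow> nx v = \<nu> v \<or> nx (\<nu> v) = v \<or> \<nu> v = \<mu> v"
  shows "perfect_matching G (ce ` {v \<in> verts G. nx v = \<nu> v} \<union>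
    me ` {v \<in> verts G. nx v \<noteq> \<nu> v \<and> nx (\<nu> v) \<noteq> v})" (is "perfect_matching G (?C \<union> ?M)")
proof (rule perfect_matchingI[OF loopless])
  have \<nu>V: "\<nu> v \<in> verts G" "\<nu> (\<nu> v) = v" if "v \<in> verts G" for v
    using invol_onD[OF \<nu> that] by auto
  fix v assume v: "v \<in> verts G"
  have C: "e = ce v \<and> nx v = \<nu> v \<or> e = ce (\<nu> v) \<and> nx (\<nu> v) = v" if e: "e \<in> ?C" "v \<in> ends G e" for e
  proof -
    obtain w where w: "w \<in> verts G" "nx w = \<nu> w" "e = ce w" using e(1) by auto
    then have "v = w \<or> v = nx w" using e(2) ce[OF w(1)] by auto
    then show ?thesis using w \<nu>V[OF w(1)] by auto
  qed
  have M: "e = me v \<and> nx v \<noteq> \<nu> v \<and> nx (\<nu> v) \<noteq> v" if e: "e \<in> ?M" "v \<in> ends G e" for e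
  proof -
    obtain w where w: "w \<in> verts G" "nx w \<noteq> \<nu> w" "nx (\<nu> w) \<noteq> w" "e = me w" using e(1) by auto
    then have "v = w \<or> v = \<mu> w" "\<nu> w = \<mu> w" using e(2) me[OF w(1)] adj[OF w(1)] by auto
    then show ?thesis using w \<nu>V[OF w(1)] me_\<mu>[OF w(1)] by auto
  qed
  have not_both: "\<not> (nx v = \<nu> v \<and> nx (\<nu> v) = v)" using no2[OF v] by auto
  define e0 where "e0 = (if nx v = \<nu> v then ce v else if nx (\<nu> v) = v then ce (\<nu> v) else me v)"
  have "e0 \<in> ?C \<union> ?M" "v \<in> ends G e0"
    using v \<nu>V[OF v] ce[OF v] ce[OF \<nu>V(1)[OF v]] me[OF v] unfolding e0_def by auto
  moreover have "e = e0" if "e \<in> ?C \<union> ?M" "v \<in> ends G e" for e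
  proof (cases "e \<in> ?C")
    case True
    then show ?thesis using C[OF True that(2)] not_both by (auto simp: e0_def)
  next
    case False
    then show ?thesis using M[of e] that by (auto simp: e0_def)
  qed
  ultimately have "{e \<in> ?C \<union> ?M. v \<in> ends G e} = {e0}" by blast
  then show "\<exists>e. {e \<in> ?C \<union> ?M. v \<in> ends G e} = {e}" by blast
qed (use edges_G in auto)

end

section \<open>Crossing edges between the two circuits\<close>

locale two_circuit_graph = circuit_graph G ce me nx \<mu>
  for G :: "('v, 'e) multigraph" and ce me nx \<mu> +
  fixes vs us :: "'v list"
  assumes lists: "distinct vs" "distinct us" "set vs \<inter> set us = {}" "set vs \<union> set us = verts G"
      "length vs \<ge> 2" "length us \<ge> 2"
    and cyc_vs: "cyc vs = (\<lambda>v. (v, nx v)) ` set vs"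
    and cyc_us: "cyc us = (\<lambda>v. (v, nx v)) ` set us"
    and bridgeless_G: "bridgeless G"
begin

definition crossing :: "'v set" where
  "crossing = {v \<in> verts G. (v \<in> set vs) \<noteq> (\<mu> v \<in> set vs)}"

lemma crossing_\<mu>:
  assumes "v \<in> crossing"
  shows "\<mu> v \<in> crossing" "v \<in> set vs \<longleftrightarrow> \<mu> v \<in> set us" "\<mu> (\<mu> v) = v"
  using assms \<mu>(1) lists(3,4) unfolding crossing_def invol_on_def by auto

lemma same_side:
  assumes "v \<in> verts G - crossing"
  shows "v \<in> set vs \<longleftrightarrow> \<mu> v \<in> set vs" "\<mu> v \<in> verts G - crossing" "\<mu> (\<mu> v) = v"
  using assms \<mu>(1) unfolding crossing_def invol_on_def by auto

lemma invol_sides: "invol_on (set vs - crossing) \<mu>" "invol_on (set us - crossing) \<mu>"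
proof -
  show "invol_on (set vs - crossing) \<mu>"
    unfolding invol_on_def
  proof (intro ballI)
    fix v assume "v \<in> set vs - crossing"
    then show "\<mu> v \<in> set vs - crossing \<and> \<mu> (\<mu> v) = v"
      using same_side[of v] lists(4) by blast
  qed
  show "invol_on (set us - crossing) \<mu>"
    unfolding invol_on_def
  proof (intro ballI)
    fix v assume "v \<in> set us - crossing"
    then show "\<mu> v \<in> set us - crossing \<and> \<mu> (\<mu> v) = v"
      using same_side[of v] lists(3,4) by blast
  qed
qed

lemma nx_sides: "v \<in> set vs \<Longrightarrow> nx v \<in> set vs" "v \<in> set us \<Longrightarrow> nx v \<in> set us"
proof -
  have "(u, v) \<in> cyc xs \<Longrightarrow> v \<in> set xs" for u v and xs :: "'v list"
    by (cases xs) (auto simp: cyc_def dest!: arcs_sub)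
  then show "v \<in> set vs \<Longrightarrow> nx v \<in> set vs" "v \<in> set us \<Longrightarrow> nx v \<in> set us"
    using cyc_vs cyc_us by blast+
qed

lemma not_one_crossing: "set vs \<inter> crossing \<noteq> {a}"
proof
  assume one: "set vs \<inter> crossing = {a}"
  then have a: "a \<in> verts G" "a \<in> set vs" "\<mu> a \<notin> set vs" "\<mu> a \<in> verts G"
    using crossing_\<mu>[of a] lists(3) \<mu>(1) by (auto simp: crossing_def invol_on_def)
  let ?H = "delete_edge (me a) G"
  \<comment> \<open>Once \<open>me a\<close> is deleted, no edge leaves \<open>set vs\<close>:
    circuit edges stay on their side, and the other matching edges at \<open>set vs\<close> join
    non-crossing vertices.\<close>
  have step: "y \<in> set vs" if "x \<in> set vs" "e \<in> edges ?H" "ends ?H e = {x, y}" for x y e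
  proof -
    have e: "e \<in> edges G" "e \<noteq> me a" "ends G e = {x, y}" using that by (auto simp: delete_edge_def)
    from e(1) edges_G consider w where "w \<in> verts G" "e = ce w" | w where "w \<in> verts G" "e = me w" by auto
    then show ?thesis
    proof cases
      case 1
      then have "{x, y} = {w, nx w}" using e(3) ce[OF 1(1)] by metis
      then have xy: "x = w \<and> y = nx w \<or> x = nx w \<and> y = w" by (simp add: doubleton_eq_iff)
      then have "w \<notin> set us" using that(1) nx_sides(2)[of w] lists(3) by blast
      then have "w \<in> set vs" using 1(1) lists(4) by blast
      then show ?thesis using nx_sides(1) xy by blast
    next
      case 2
      have xV: "x \<in> verts G" using that(1) lists by auto
      have "{x, y} = {w, \<mu> w}" using e(3) me[OF 2(1)] 2(2) by metis
      then have "x = w \<and> y = \<mu> w \<or> x = \<mu> w \<and> y = w" by (simp add: doubleton_eq_iff)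
      then have "me x = e" "y = \<mu> x"
        using 2 me_\<mu>[OF 2(1)] invol_onD(2)[OF \<mu>(1) 2(1)] by metis+
      then have "x \<noteq> a" using e(2) by auto
      then have "x \<notin> crossing" using one that(1) by auto
      then show ?thesis using same_side(1)[of x] xV that(1) \<open>y = \<mu> x\<close> by auto
    qed
  qed
  have "y \<in> set vs" if "reachable ?H a y" for y
    using that unfolding reachable_def
    by (induction rule: rtrancl_induct) (use a step in auto)
  then have "\<not> reachable ?H a (\<mu> a)" using a by auto
  then have "bridge G (me a)" using me[OF a(1)] unfolding bridge_def by blast
  then show False using bridgeless_G me[OF a(1)] unfolding bridgeless_def by blast
qed

text \<open>The single perfect matching that \<open>perfect_matching_involution\<close> decodes from
  \<open>\<nu>\<close>.\<close>

definition cover_of :: "('v \<Rightarrow> 'v) \<Rightarrow> 'e set" where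
  "cover_of \<nu> = ce ` {v \<in> verts G. nx v = \<nu> v} \<union> me ` {v \<in> verts G. nx v \<noteq> \<nu> v \<and> nx (\<nu> v) \<noteq> v}"

text \<open>Near matchings of the two circuits that miss the two ends of a crossing edge are glued
  by adding this edge.\<close>

lemma perfect_matching_sides:
  assumes odd: "odd (length vs)" "odd (length us)" and x: "x \<in> set vs \<inter> crossing"
    and f: "near_matching (set vs) (cyc vs) crossing \<mu> x f"
    and g: "near_matching (set us) (cyc us) crossing \<mu> (\<mu> x) g"
  obtains N where "perfect_matching G N" "\<And>v. v \<in> set vs \<Longrightarrow> f v = nx v \<Longrightarrow> ce v \<in> N"
    "\<And>v. v \<in> set us \<Longrightarrow> g v = nx v \<Longrightarrow> ce v \<in> N"
proof -
  have no_fix: "nx v \<noteq> v" if "v \<in> verts G" for v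
  proof
    assume "nx v = v"
    then have "card (ends G (ce v)) = 1" using ce[OF that] by simp
    then show False using ce[OF that] loopless by (auto simp: loopless_graph_def)
  qed
  have no2: "nx (nx v) \<noteq> v" if "v \<in> verts G" for v
  proof (cases "v \<in> set vs")
    case True
    then show ?thesis using successor_not_involutive[OF lists(1) odd(1), of v nx] cyc_vs no_fix[OF that] by blast
  next
    case False
    then have "v \<in> set us" using that lists(4) by blast
    then show ?thesis using successor_not_involutive[OF lists(2) odd(2), of v nx] cyc_us no_fix[OF that] by blast
  qed
  have mx: "\<mu> x \<in> set us" "\<mu> (\<mu> x) = x" using crossing_\<mu>[of x] x by auto
  have cycD: "nx u = v" if "(u, v) \<in> cyc vs \<union> cyc us" for u v
    using that unfolding cyc_vs cyc_us by blast
  have f': "f x = x" "invol_on (set vs) f"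
    "\<And>v. v \<in> set vs \<Longrightarrow> v \<noteq> x \<Longrightarrow> nx v = f v \<or> nx (f v) = v \<or> f v = \<mu> v"
    using f cycD unfolding near_matching_def by blast+
  have g': "g (\<mu> x) = \<mu> x" "invol_on (set us) g"
    "\<And>v. v \<in> set us \<Longrightarrow> v \<noteq> \<mu> x \<Longrightarrow> nx v = g v \<or> nx (g v) = v \<or> g v = \<mu> v"
    using g cycD unfolding near_matching_def by blast+
  define \<nu> where "\<nu> = (\<lambda>v. if v = x then \<mu> x else if v = \<mu> x then x else if v \<in> set vs then f v else g v)"
  have \<nu>1: "\<nu> v = f v" "f v \<in> set vs - {x}" "f (f v) = v" if "v \<in> set vs - {x}" for v
  proof -
    have "f v \<in> set vs" "f (f v) = v" using invol_onD[OF f'(2), of v] that by auto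
    moreover from this have "f v \<noteq> x" using f'(1) that by auto
    ultimately show "f v \<in> set vs - {x}" "f (f v) = v" by auto
    show "\<nu> v = f v" using that mx lists(3) by (auto simp: \<nu>_def)
  qed
  have \<nu>2: "\<nu> v = g v" "g v \<in> set us - {\<mu> x}" "g (g v) = v" if "v \<in> set us - {\<mu> x}" for v
  proof -
    have "g v \<in> set us" "g (g v) = v" using invol_onD[OF g'(2), of v] that by auto
    moreover from this have "g v \<noteq> \<mu> x" using g'(1) that by auto
    ultimately show "g v \<in> set us - {\<mu> x}" "g (g v) = v" by auto
    show "\<nu> v = g v" using that x lists(3) by (auto simp: \<nu>_def)
  qed
  have \<nu>x: "\<nu> x = \<mu> x" "\<nu> (\<mu> x) = x" using mx x lists(3) by (auto simp: \<nu>_def)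
  have cases: "v = x \<or> v = \<mu> x \<or> v \<in> set vs - {x} \<or> v \<in> set us - {\<mu> x}" if "v \<in> verts G" for v
    using that lists(4) by blast
  have inv: "invol_on (verts G) \<nu>"
    unfolding invol_on_def
  proof (intro ballI)
    fix v assume v: "v \<in> verts G"
    from cases[OF v] consider "v = x" | "v = \<mu> x" | "v \<in> set vs - {x}" | "v \<in> set us - {\<mu> x}" by blast
    then show "\<nu> v \<in> verts G \<and> \<nu> (\<nu> v) = v"
    proof cases
      case 3
      then show ?thesis using \<nu>1[OF 3] \<nu>1(1)[of "f v"] lists(4) by auto
    next
      case 4
      then show ?thesis using \<nu>2[OF 4] \<nu>2(1)[of "g v"] lists(4) by auto
    qed (use \<nu>x mx x lists(4) in auto)
  qed
  have adj: "nx v = \<nu> v \<or> nx (\<nu> v) = v \<or> \<nu> v = \<mu> v" if v: "v \<in> verts G" for v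
  proof -
    from cases[OF v] consider "v = x" | "v = \<mu> x" | "v \<in> set vs - {x}" | "v \<in> set us - {\<mu> x}" by blast
    then show ?thesis
    proof cases
      case 3
      then show ?thesis using \<nu>1(1)[OF 3] f'(3)[of v] by simp
    next
      case 4
      then show ?thesis using \<nu>2(1)[OF 4] g'(3)[of v] by simp
    qed (use \<nu>x mx in auto)
  qed
  show thesis
  proof (rule that)
    show "perfect_matching G (cover_of \<nu>)"
      unfolding cover_of_def by (rule perfect_matching_involution[OF no2 inv adj])
    show "ce v \<in> cover_of \<nu>" if "v \<in> set vs" "f v = nx v" for v
    proof -
      have "v \<noteq> x" using that f'(1) no_fix[of v] lists(4) by (metis UnCI)
      then show ?thesis using that \<nu>1(1)[of v] lists(4) by (auto simp: cover_of_def)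
    qed
    show "ce v \<in> cover_of \<nu>" if "v \<in> set us" "g v = nx v" for v
    proof -
      have "v \<noteq> \<mu> x" using that g'(1) no_fix[of v] lists(4) by (metis UnCI)
      then show ?thesis using that \<nu>2(1)[of v] lists(4) by (auto simp: cover_of_def)
    qed
  qed
qed

end

section \<open>Assembling the five perfect matchings\<close>

lemma arcs_two_colouring:
  "distinct xs \<Longrightarrow> xs \<noteq> [] \<Longrightarrow> \<exists>col. col (hd xs) \<and> (col (last xs) \<longleftrightarrow> odd (length xs)) \<and>
    (\<forall>(u, v)\<in>arcs xs. col u \<noteq> col v)"
proof (induction xs)
  case (Cons x xs)
  show ?case
  proof (cases "xs = []")
    case False
    then obtain col where col: "col (hd xs)" "col (last xs) \<longleftrightarrow> odd (length xs)"
      "\<forall>(u, v)\<in>arcs xs. col u \<noteq> col v"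
      using Cons by auto
    \<comment> \<open>The colours of the tail are flipped, so that the new head is coloured true
      again.\<close>
    let ?col = "\<lambda>v. v = x \<or> \<not> col v"
    have x: "x \<notin> set xs" "hd xs \<in> set xs" "last xs \<in> set xs" using Cons.prems False by auto
    have "?col u \<noteq> ?col v" if "(u, v) \<in> arcs (x # xs)" for u v
    proof -
      from that consider "u = x" "v = hd xs" | "(u, v) \<in> arcs xs"
        unfolding arcs_Cons[OF False] by auto
      then show ?thesis
      proof cases
        case 2
        then show ?thesis using col(3) arcs_sub[OF 2] x(1) by auto
      qed (use col x in auto)
    qed
    then show ?thesis using col x False by (intro exI[of _ ?col]) auto
  qed (auto intro: exI[of _ "\<lambda>_. True"])
qed simp

lemma cyc_two_colouring:
  assumes "distinct xs" "even (length xs)"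
  obtains col :: "'a \<Rightarrow> bool" where "\<And>u v. (u, v) \<in> cyc xs \<Longrightarrow> col u \<noteq> col v"
proof (cases "xs = []")
  case False
  obtain col where col: "col (hd xs)" "col (last xs) \<longleftrightarrow> odd (length xs)"
    "\<forall>(u, v)\<in>arcs xs. col u \<noteq> col v"
    using arcs_two_colouring[OF assms(1) False] by blast
  have "cyc xs = arcs xs \<union> {(last xs, hd xs)}"
    using arcs_append[OF False, of "[hd xs]"] by (simp add: cyc_def)
  then show thesis using that[of col] col assms(2) by auto
qed (use that in \<open>auto simp: cyc_def\<close>)

context two_circuit_graph
begin

lemma perfect_matching_coverI:
  assumes "\<And>M. M \<in># \<M> \<Longrightarrow> perfect_matching G M"
    and "\<And>v. v \<in> verts G \<Longrightarrow> \<exists>M\<in>#\<M>. ce v \<in> M"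
    and "me ` verts G \<in># \<M>"
  shows "perfect_matching_cover G \<M>"
  unfolding perfect_matching_cover_def
proof (intro conjI ballI)
  fix e assume "e \<in> edges G"
  then have "(\<exists>v\<in>verts G. e = ce v) \<or> e \<in> me ` verts G" using edges_G by auto
  then show "\<exists>M\<in>#\<M>. e \<in> M" using assms(2,3) by auto
qed (use assms(1) in auto)

lemma arc: "v \<in> set vs \<Longrightarrow> (v, nx v) \<in> cyc vs" "v \<in> set us \<Longrightarrow> (v, nx v) \<in> cyc us"
  using cyc_vs cyc_us by auto

lemma cover_even:
  assumes "even (length vs)" "even (length us)"
  shows "\<exists>\<M>. perfect_matching_cover G \<M> \<and> size \<M> = 5"
proof -
  obtain cv cu :: "'v \<Rightarrow> bool" where cv: "\<And>u v. (u, v) \<in> cyc vs \<Longrightarrow> cv u \<noteq> cv v"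
    and cu: "\<And>u v. (u, v) \<in> cyc us \<Longrightarrow> cu u \<noteq> cu v"
    using cyc_two_colouring[OF lists(1) assms(1)] cyc_two_colouring[OF lists(2) assms(2)] by metis
  define col where "col v = (if v \<in> set vs then cv v else cu v)" for v
  let ?N = "\<lambda>t. ce ` {v \<in> verts G. col v = t}"
  have col: "col (nx v) \<noteq> col v" if v: "v \<in> verts G" for v
  proof (cases "v \<in> set vs")
    case True
    then show ?thesis using nx_sides(1) cv[OF arc(1)] by (auto simp: col_def)
  next
    case False
    then have "v \<in> set us" "nx v \<notin> set vs" using v nx_sides(2) lists(3,4) by blast+
    then show ?thesis using False cu[OF arc(2)] by (auto simp: col_def)
  qed
  have N: "perfect_matching G (?N t)" for t
    by (rule perfect_matching_alternating[of col, OF col])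
  let ?M = "me ` verts G"
  \<comment> \<open>Three matchings suffice here; \<open>?M\<close> is repeated to reach order
    five.\<close>
  have "perfect_matching_cover G {#?N True, ?N False, ?M, ?M, ?M#}"
  proof (rule perfect_matching_coverI)
    show "perfect_matching G M" if "M \<in># {#?N True, ?N False, ?M, ?M, ?M#}" for M
    proof -
      have "M = ?N True \<or> M = ?N False \<or> M = ?M" using that by simp
      then show ?thesis using N[of True] N[of False] perfect_matching_me by (elim disjE) (simp_all only:)
    qed
  qed auto
  then show ?thesis by (intro exI conjI) auto
qed

lemma same_parity: "even (length vs) \<longleftrightarrow> even (length us)"
proof -
  have "even (card (verts G))"
    using loopless \<mu> by (intro invol_on_even_card[of _ \<mu>]) (auto simp: loopless_graph_def)
  moreover have "card (verts G) = length vs + length us"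
    using lists(1-4) distinct_card card_Un_disjoint finite_set by metis
  ultimately show ?thesis by simp
qed

lemma two_crossings:
  assumes "odd (length vs)"
  obtains a b where "a \<in> crossing \<inter> set vs" "b \<in> crossing \<inter> set vs" "a \<noteq> b"
proof -
  have "\<mu> v \<noteq> v" if "v \<in> set vs - crossing" for v using \<mu>(2) that lists(4) by blast
  then have "even (card (set vs - crossing))"
    by (intro invol_on_even_card[OF _ invol_sides(1)]) simp_all
  moreover have "card (set vs - crossing) + card (set vs \<inter> crossing) = length vs"
    using distinct_card[OF lists(1)] card_Int_Diff[OF finite_set, of vs crossing] by simp
  ultimately have "set vs \<inter> crossing \<noteq> {}" using assms by auto
  then obtain a where a: "a \<in> set vs \<inter> crossing" by blast
  moreover obtain b where "b \<in> set vs \<inter> crossing" "a \<noteq> b"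
    using a not_one_crossing[of a] by blast
  ultimately show thesis using that by blast
qed

lemma cover_odd:
  assumes odd_vs: "odd (length vs)"
  shows "\<exists>\<M>. perfect_matching_cover G \<M> \<and> size \<M> = 5"
proof -
  have odd_us: "odd (length us)" using odd_vs same_parity by blast
  have nf: "\<mu> v \<noteq> v" if "v \<in> set vs - crossing \<or> v \<in> set us - crossing" for v
    using \<mu>(2) that lists(4) by blast
  obtain a b where ab: "a \<in> crossing \<inter> set vs" "b \<in> crossing \<inter> set vs" "a \<noteq> b"
    using two_crossings[OF odd_vs] by blast
  have \<mu>ab: "\<mu> a \<in> crossing \<inter> set us" "\<mu> b \<in> crossing \<inter> set us" "\<mu> a \<noteq> \<mu> b"
    using ab crossing_\<mu>[of a] crossing_\<mu>[of b] by auto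
  obtain c where c: "c \<in> crossing \<inter> set vs" "triple_cover (set vs) (cyc vs) crossing \<mu> {a, b, c}"
    using circle_triple_cover'[OF lists(1) odd_vs ab invol_sides(1)] nf by metis
  obtain d where d: "d \<in> crossing \<inter> set us"
    "triple_cover (set us) (cyc us) crossing \<mu> {\<mu> a, \<mu> b, d}"
    using circle_triple_cover'[OF lists(2) odd_us \<mu>ab invol_sides(2)] nf by metis
  from c(2) obtain f where f: "\<And>z. z \<in> {a, b, c} \<Longrightarrow> near_matching (set vs) (cyc vs) crossing \<mu> z (f z)"
    "\<forall>(u, v)\<in>cyc vs. \<exists>z\<in>{a, b, c}. f z u = v"
    unfolding triple_cover_def by (elim exE conjE) blast
  from d(2) obtain g where g: "\<And>z. z \<in> {\<mu> a, \<mu> b, d} \<Longrightarrow> near_matching (set us) (cyc us) crossing \<mu> z (g z)"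
    "\<forall>(u, v)\<in>cyc us. \<exists>z\<in>{\<mu> a, \<mu> b, d}. g z u = v"
    unfolding triple_cover_def by (elim exE conjE) blast
  have \<mu>c: "\<mu> c \<in> set us" using c(1) crossing_\<mu>[of c] by auto
  have "d \<notin> set vs" using d(1) lists(3) by blast
  then have \<mu>d: "\<mu> d \<in> crossing \<inter> set vs" "\<mu> (\<mu> d) = d"
    using d(1) crossing_\<mu>[of d] crossing_\<mu>[of "\<mu> d"] by auto
  obtain g' where g': "near_matching (set us) (cyc us) crossing \<mu> (\<mu> c) g'"
    using near_matching_pairing[OF lists(2) odd_us \<mu>c] by blast
  obtain f' where f': "near_matching (set vs) (cyc vs) crossing \<mu> (\<mu> d) f'"
    using near_matching_pairing[OF lists(1) odd_vs] \<mu>d(1) by blast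
  have side: "a \<in> set vs \<inter> crossing" "b \<in> set vs \<inter> crossing" "c \<in> set vs \<inter> crossing"
    "\<mu> d \<in> set vs \<inter> crossing"
    using ab c(1) \<mu>d(1) by simp_all
  have fz: "near_matching (set vs) (cyc vs) crossing \<mu> a (f a)"
    "near_matching (set vs) (cyc vs) crossing \<mu> b (f b)"
    "near_matching (set vs) (cyc vs) crossing \<mu> c (f c)"
    using f(1) by simp_all
  have gz: "near_matching (set us) (cyc us) crossing \<mu> (\<mu> a) (g (\<mu> a))"
    "near_matching (set us) (cyc us) crossing \<mu> (\<mu> b) (g (\<mu> b))"
    "near_matching (set us) (cyc us) crossing \<mu> (\<mu> (\<mu> d)) (g d)"
    using g(1) \<mu>d(2) by simp_all
  obtain Na where Na: "perfect_matching G Na" "\<And>v. v \<in> set vs \<Longrightarrow> f a v = nx v \<Longrightarrow> ce v \<in> Na"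
    "\<And>v. v \<in> set us \<Longrightarrow> g (\<mu> a) v = nx v \<Longrightarrow> ce v \<in> Na"
    by (rule perfect_matching_sides[OF odd_vs odd_us side(1) fz(1) gz(1)]) (rule that)
  obtain Nb where Nb: "perfect_matching G Nb" "\<And>v. v \<in> set vs \<Longrightarrow> f b v = nx v \<Longrightarrow> ce v \<in> Nb"
    "\<And>v. v \<in> set us \<Longrightarrow> g (\<mu> b) v = nx v \<Longrightarrow> ce v \<in> Nb"
    by (rule perfect_matching_sides[OF odd_vs odd_us side(2) fz(2) gz(2)]) (rule that)
  obtain Nc where Nc: "perfect_matching G Nc" "\<And>v. v \<in> set vs \<Longrightarrow> f c v = nx v \<Longrightarrow> ce v \<in> Nc"
    "\<And>v. v \<in> set us \<Longrightarrow> g' v = nx v \<Longrightarrow> ce v \<in> Nc"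
    by (rule perfect_matching_sides[OF odd_vs odd_us side(3) fz(3) g']) (rule that)
  obtain Nd where Nd: "perfect_matching G Nd" "\<And>v. v \<in> set vs \<Longrightarrow> f' v = nx v \<Longrightarrow> ce v \<in> Nd"
    "\<And>v. v \<in> set us \<Longrightarrow> g d v = nx v \<Longrightarrow> ce v \<in> Nd"
    by (rule perfect_matching_sides[OF odd_vs odd_us side(4) f' gz(3)]) (rule that)
  let ?\<M> = "{#me ` verts G, Na, Nb, Nc, Nd#}"
  have "perfect_matching_cover G ?\<M>"
  proof (rule perfect_matching_coverI)
    fix v assume "v \<in> verts G"
    then consider "v \<in> set vs" | "v \<in> set us" using lists(4) by blast
    then show "\<exists>M\<in>#?\<M>. ce v \<in> M"
    proof cases
      case 1
      then obtain z where "z \<in> {a, b, c}" "f z v = nx v" using bspec[OF f(2) arc(1)] by auto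
      then show ?thesis using 1 Na(2) Nb(2) Nc(2) by auto
    next
      case 2
      then obtain z where "z \<in> {\<mu> a, \<mu> b, d}" "g z v = nx v" using bspec[OF g(2) arc(2)] by auto
      then show ?thesis using 2 Na(3) Nb(3) Nd(3) by auto
    qed
  qed (use perfect_matching_me Na(1) Nb(1) Nc(1) Nd(1) in auto)
  then show ?thesis by (intro exI conjI) auto
qed

theorem cover_of_order_5: "\<exists>\<M>. perfect_matching_cover G \<M> \<and> size \<M> = 5"
  using cover_even cover_odd same_parity by blast

end

section \<open>Successor and mate functions of the given graph\<close>

lemma arcs_nth: "arcs xs = (\<lambda>i. (xs ! i, xs ! Suc i)) ` {i. Suc i < length xs}"
proof (induction xs rule: arcs.induct)
  case (1 x y zs)
  have "{i. Suc i < length (x # y # zs)} = insert 0 (Suc ` {i. Suc i < length (y # zs)})"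
    by (auto simp: image_iff) (metis Suc_less_eq less_Suc_eq_0_disj not0_implies_Suc)
  then show ?case using 1 by (simp add: image_image)
qed auto

lemma cyc_nth: "cyc xs = (\<lambda>i. (xs ! i, xs ! (Suc i mod length xs))) ` {..<length xs}"
proof (cases "xs = []")
  case False
  have "(xs @ [hd xs]) ! Suc i = xs ! (Suc i mod length xs)" if "i < length xs" for i
    using that False by (cases "Suc i = length xs") (auto simp: nth_append hd_conv_nth)
  then show ?thesis unfolding cyc_def arcs_nth
    by (intro image_cong) (auto simp: nth_append)
qed (simp add: cyc_def)

lemma circuit_successor:
  assumes "circuit C"
  obtains vs ce nx where "length vs \<ge> 2" "distinct vs" "verts C = set vs"
    "cyc vs = (\<lambda>v. (v, nx v)) ` set vs" "bij_betw nx (set vs) (set vs)"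
    "inj_on ce (set vs)" "edges C = ce ` set vs" "\<And>v. v \<in> set vs \<Longrightarrow> ends C (ce v) = {v, nx v}"
proof -
  obtain vs es where C: "length vs \<ge> 2" "length es = length vs" "distinct vs" "distinct es"
    "verts C = set vs" "edges C = set es"
    "\<forall>i<length vs. ends C (es ! i) = {vs ! i, vs ! (Suc i mod length vs)}"
    using assms unfolding circuit_def by (elim exE conjE) blast
  let ?n = "length vs"
  define idx where "idx = the_inv_into {..<?n} ((!) vs)"
  have bij: "bij_betw ((!) vs) {..<?n} (set vs)" using C(3) by (intro bij_betw_nth) auto
  have idx: "idx (vs ! i) = i" if "i < ?n" for i
    using the_inv_into_f_f[of "(!) vs" "{..<?n}" i] bij that by (auto simp: idx_def bij_betw_def)
  have vs_image: "set vs = (!) vs ` {..<?n}" using bij by (simp add: bij_betw_def)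
  define nx where "nx v = vs ! (Suc (idx v) mod ?n)" for v
  define ce where "ce v = es ! idx v" for v
  have cyc: "cyc vs = (\<lambda>v. (v, nx v)) ` set vs"
    unfolding cyc_nth vs_image image_image using idx by (intro image_cong) (auto simp: nx_def)
  have "nx ` set vs = set vs"
  proof (intro equalityI subsetI)
    fix v assume "v \<in> set vs"
    then obtain j where j: "j < ?n" "v = vs ! j" by (auto simp: in_set_conv_nth)
    \<comment> \<open>The cyclic predecessor of \<open>j\<close>; adding \<open>?n - 1\<close>
      avoids truncated subtraction at \<open>j = 0\<close>.\<close>
    let ?i = "(j + (?n - 1)) mod ?n"
    have "?i < ?n" using C(1) by (intro mod_less_divisor) linarith
    moreover have "Suc (j + (?n - 1)) = j + ?n" using C(1) by linarith
    then have "Suc ?i mod ?n = j" unfolding mod_Suc_eq using j(1) by simp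
    ultimately have "v = nx (vs ! ?i)" "vs ! ?i \<in> set vs" using idx[of ?i] j by (auto simp: nx_def)
    then show "v \<in> nx ` set vs" by blast
  next
    fix v assume "v \<in> nx ` set vs"
    moreover have "Suc (idx w) mod ?n < ?n" for w using C(1) by (intro mod_less_divisor) linarith
    ultimately show "v \<in> set vs" by (auto simp: nx_def)
  qed
  then have nx: "bij_betw nx (set vs) (set vs)"
    using eq_card_imp_inj_on[of "set vs" nx] by (simp add: bij_betw_def)
  have ce: "inj_on ce (set vs)"
    unfolding vs_image using idx C(2,4) by (auto simp: inj_on_def ce_def nth_eq_iff_index_eq)
  have "set es = (!) es ` {..<?n}" using C(2) by (auto simp: set_conv_nth)
  also have "\<dots> = ce ` set vs"
    unfolding vs_image image_image using idx by (intro image_cong) (auto simp: ce_def)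
  finally have es: "edges C = ce ` set vs" using C(6) by simp
  have "ends C (ce v) = {v, nx v}" if "v \<in> set vs" for v
    using that idx C(7) by (auto simp: in_set_conv_nth nx_def ce_def)
  then show thesis using that C(1,3,5) cyc nx ce es by blast
qed

theorem theorem3p4:
  fixes G F :: "('v, 'e) multigraph"
  assumes "loopless_graph G"
    and "cubic G"
    and "bridgeless G"
    and "factor 2 F G"
    and "consists_of_two_circuits F"
  shows "\<exists>\<M>. perfect_matching_cover G \<M> \<and> size \<M> = 5"
proof -
  have F: "verts F = verts G" "edges F \<subseteq> edges G" "\<And>e. e \<in> edges F \<Longrightarrow> ends F e = ends G e"
    "\<And>v. v \<in> verts G \<Longrightarrow> degree F v = 2"
    using assms(4) unfolding factor_def spanning_subgraph_def subgraph_def regular_def by auto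
  obtain C D where CD: "subgraph C F" "subgraph D F" "circuit C" "circuit D"
    "verts C \<inter> verts D = {}" "verts F = verts C \<union> verts D" "edges F = edges C \<union> edges D"
    using assms(5) unfolding consists_of_two_circuits_def by blast
  have ends: "ends C e = ends G e" if "e \<in> edges C" for e
    using that CD(1) F(3) unfolding subgraph_def by auto
  have ends': "ends D e = ends G e" if "e \<in> edges D" for e
    using that CD(2) F(3) unfolding subgraph_def by auto
  obtain vs ce1 nx1 where C: "length vs \<ge> 2" "distinct vs" "verts C = set vs"
    "cyc vs = (\<lambda>v. (v, nx1 v)) ` set vs" "bij_betw nx1 (set vs) (set vs)"
    "inj_on ce1 (set vs)" "edges C = ce1 ` set vs" "\<And>v. v \<in> set vs \<Longrightarrow> ends C (ce1 v) = {v, nx1 v}"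
    by (rule circuit_successor[OF CD(3)]) (rule that)
  obtain us ce2 nx2 where D: "length us \<ge> 2" "distinct us" "verts D = set us"
    "cyc us = (\<lambda>v. (v, nx2 v)) ` set us" "bij_betw nx2 (set us) (set us)"
    "inj_on ce2 (set us)" "edges D = ce2 ` set us" "\<And>v. v \<in> set us \<Longrightarrow> ends D (ce2 v) = {v, nx2 v}"
    by (rule circuit_successor[OF CD(4)]) (rule that)
  have disj: "set vs \<inter> set us = {}" and un: "set vs \<union> set us = verts G"
    using CD(5,6) F(1) C(3) D(3) by auto
  define nx where "nx v = (if v \<in> set vs then nx1 v else nx2 v)" for v
  define ce where "ce v = (if v \<in> set vs then ce1 v else ce2 v)" for v
  have on_vs: "nx v = nx1 v" "ce v = ce1 v" if "v \<in> set vs" for v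
    using that by (auto simp: nx_def ce_def)
  have on_us: "nx v = nx2 v" "ce v = ce2 v" if "v \<in> set us" for v
    using that disj by (auto simp: nx_def ce_def)
  have edges_F: "edges F = ce ` verts G"
    using CD(7) C(7) D(7) on_vs(2) on_us(2) un by (metis image_Un image_cong)
  have ends_ce: "ends G (ce v) = {v, nx v}" if "v \<in> verts G" for v
  proof (cases "v \<in> set vs")
    case True
    then show ?thesis using C(7,8) ends on_vs by auto
  next
    case False
    then have "v \<in> set us" using that un by blast
    then show ?thesis using D(7,8) ends' on_us by auto
  qed
  have nx_vs: "nx v \<in> set vs" if "v \<in> set vs" for v using that on_vs(1) C(5) bij_betwE by metis
  have nx_us: "nx v \<in> set us" if "v \<in> set us" for v using that on_us(1) D(5) bij_betwE by metis
  have "bij_betw nx (set vs) (set vs)" using C(5) on_vs(1) bij_betw_cong by metis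
  moreover have "bij_betw nx (set us) (set us)" using D(5) on_us(1) bij_betw_cong by metis
  ultimately have bij_nx: "bij_betw nx (verts G) (verts G)"
    using bij_betw_combine disj un by metis
  have "inj_on ce (set vs)" "inj_on ce (set us)"
    using C(6) D(6) on_vs(2) on_us(2) inj_on_cong by metis+
  \<comment> \<open>Edges of different circuits have disjoint sets of ends, so \<open>ce\<close>
    stays injective on the union.\<close>
  moreover have "ce v \<noteq> ce w" if "v \<in> set vs" "w \<in> set us" for v w
  proof
    assume "ce v = ce w"
    then have "{v, nx v} = {w, nx w}" using ends_ce[of v] ends_ce[of w] that un by auto
    then have "v \<in> {w, nx w}" by blast
    then show False using that nx_us[of w] disj by blast
  qed
  ultimately have inj_ce: "inj_on ce (verts G)"
    unfolding un[symmetric] inj_on_Un by blast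
  \<comment> \<open>Every vertex has degree three in \<open>G\<close> and two in \<open>F\<close>,
    so a single edge outside \<open>F\<close> meets it; this edge becomes
    \<open>me v\<close>.\<close>
  have "\<exists>e. {e \<in> edges G - edges F. v \<in> ends G e} = {e}" if v: "v \<in> verts G" for v
  proof -
    have "{e \<in> edges G. v \<in> ends G e} =
      {e \<in> edges F. v \<in> ends F e} \<union> {e \<in> edges G - edges F. v \<in> ends G e}"
      using F(2,3) by auto
    moreover have "finite (edges G)" using assms(1) by (simp add: loopless_graph_def)
    moreover from this have "finite (edges F)" using F(2) finite_subset by blast
    ultimately have "degree G v = degree F v + card {e \<in> edges G - edges F. v \<in> ends G e}"
      unfolding degree_def by (simp add: card_Un_disjoint disjoint_iff)
    then have "card {e \<in> edges G - edges F. v \<in> ends G e} = 1"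
      using assms(2) v F(4)[OF v] by (simp add: regular_def)
    then show ?thesis by (simp add: card_1_singleton_iff)
  qed
  then obtain me where me_set: "\<And>v. v \<in> verts G \<Longrightarrow> {e \<in> edges G - edges F. v \<in> ends G e} = {me v}"
    by metis
  have me: "me v \<in> edges G - edges F" "v \<in> ends G (me v)" if "v \<in> verts G" for v
    using me_set[OF that] by auto
  have me_unique: "e = me v" if "v \<in> verts G" "e \<in> edges G - edges F" "v \<in> ends G e" for v e
    using me_set[OF that(1)] that(2,3) by auto
  have edge: "ends G e \<subseteq> verts G" "card (ends G e) = 2" if "e \<in> edges G" for e
    using assms(1) that by (auto simp: loopless_graph_def)
  have "\<exists>w. ends G (me v) = {v, w} \<and> w \<noteq> v" if v: "v \<in> verts G" for v
    using me[OF v] edge(2)[of "me v"] by (auto simp: card_2_iff)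
  then obtain \<mu> where \<mu>: "\<And>v. v \<in> verts G \<Longrightarrow> ends G (me v) = {v, \<mu> v}" "\<And>v. v \<in> verts G \<Longrightarrow> \<mu> v \<noteq> v"
    by metis
  have \<mu>V: "\<mu> v \<in> verts G" if "v \<in> verts G" for v
    using edge(1)[of "me v"] me(1)[OF that] \<mu>(1)[OF that] by auto
  have me_\<mu>: "me (\<mu> v) = me v" if "v \<in> verts G" for v
    using me_unique[OF \<mu>V[OF that] me(1)[OF that]] \<mu>(1)[OF that] by auto
  have "\<mu> (\<mu> v) = v" if "v \<in> verts G" for v
    using \<mu>[OF that] \<mu>[OF \<mu>V[OF that]] me_\<mu>[OF that] by (auto simp: doubleton_eq_iff)
  then have invol: "invol_on (verts G) \<mu>" using \<mu>V by (simp add: invol_on_def)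
  have edges_G: "edges G = ce ` verts G \<union> me ` verts G"
  proof (intro equalityI subsetI)
    fix e assume e: "e \<in> edges G"
    show "e \<in> ce ` verts G \<union> me ` verts G"
    proof (cases "e \<in> edges F")
      case False
      obtain v where "v \<in> ends G e" using edge(2)[OF e] by fastforce
      then show ?thesis using me_unique[of v e] edge(1)[OF e] e False by blast
    qed (use edges_F in auto)
  qed (use edges_F F(2) me in auto)
  interpret two_circuit_graph G ce me nx \<mu> vs us
  proof
    show "cyc vs = (\<lambda>v. (v, nx v)) ` set vs" using C(4) on_vs(1) by simp
    show "cyc us = (\<lambda>v. (v, nx v)) ` set us" using D(4) on_us(1) by simp
    show "ce v \<in> edges G \<and> ends G (ce v) = {v, nx v}" if "v \<in> verts G" for v
      using that edges_F F(2) ends_ce by auto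
    show "me v \<in> edges G \<and> ends G (me v) = {v, \<mu> v}" if "v \<in> verts G" for v
      using me(1)[OF that] \<mu>(1)[OF that] by simp
  qed (use assms C D disj un bij_nx inj_ce \<mu> me_\<mu> invol edges_G in auto)
  show ?thesis by (rule cover_of_order_5)
qed

end
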